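(* Let $M$ be a matroid on a finite ground set of cardinality $n$, and let $G$ be the automorphism group of $M$. Then for every $i\ge 0$ there is an isomorphism of $\mathbb{C}[G]$-modules $$\widetilde{H}_{i}(NS(M),\mathbb{C})\;\simeq_{G}\;\widetilde{H}_{n-3-i}(IN(M^{*}),\mathbb{C})\otimes\mathrm{sgn}.$$
   Context: Let $E$ be the ground set of $M$ and $\mathrm{rk}$ its rank function. $M^{*}$ is the dual matroid of $M$. $IN(M^{*})$ is the abstract simplicial complex of independent sets of $M^{*}$. $NS(M)=\{A\subseteq E:\mathrm{rk}(A)<\mathrm{rk}(E)\}$ is the abstract simplicial complex of non-spanning subsets of $M$. $G$, the group of permutations of $E$ preserving the family of independent sets of $M$, acts on both complexes, on oriented simplices by $g[j_1,\dots,j_k]=[g(j_1),\dots,g(j_k)]$, and hence on their reduced homology $\widetilde{H}_{*}$ with complex coefficients. $\mathrm{sgn}$ is the restriction to $G$ of the sign representation of the symmetric group $\mathfrak{S}_n$ of permutations of $E$. *)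

theory Defs
  imports
    "HOL-Algebra.Algebraic_Closure_Type"
    "HOL-Algebra.Module"
    "HOL-Combinatorics.Permutations"
    Complex_Main
begin

section \<open>Complex group modules\<close>

record ('g, 'v) cg_module = "(complex, 'v) module" +
  gact :: "'g \<Rightarrow> 'v \<Rightarrow> 'v"

text \<open>The fields \<open>mult\<close> and \<open>one\<close> inherited from the record of modules are junk.
  Since \<open>G\<close> acts by linear automorphisms, this is the same data as a module over the group
  algebra of \<open>G\<close>.\<close>

locale cg_module =
  group G + module "ring_of_type_algebra :: complex ring" V
  for G :: "('g, 'r) monoid_scheme" (structure) and V :: "('g, 'v) cg_module" (structure) +
  assumes gact_closed: "g \<in> carrier G \<Longrightarrow> x \<in> carrier V \<Longrightarrow> gact V g x \<in> carrier V"
    and gact_add: "g \<in> carrier G \<Longrightarrow> x \<in> carrier V \<Longrightarrow> y \<in> carrier V \<Longrightarrow>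
      gact V g (x \<oplus>\<^bsub>V\<^esub> y) = gact V g x \<oplus>\<^bsub>V\<^esub> gact V g y"
    and gact_smult: "g \<in> carrier G \<Longrightarrow> x \<in> carrier V \<Longrightarrow>
      gact V g (a \<odot>\<^bsub>V\<^esub> x) = a \<odot>\<^bsub>V\<^esub> gact V g x"
    and gact_one: "x \<in> carrier V \<Longrightarrow> gact V \<one>\<^bsub>G\<^esub> x = x"
    and gact_mult: "g \<in> carrier G \<Longrightarrow> h \<in> carrier G \<Longrightarrow> x \<in> carrier V \<Longrightarrow>
      gact V (g \<otimes>\<^bsub>G\<^esub> h) x = gact V g (gact V h x)"

definition cg_isomorphic ::
    "('g, 'r) monoid_scheme \<Rightarrow> ('g, 'v) cg_module \<Rightarrow> ('g, 'w) cg_module \<Rightarrow> bool" where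
  "cg_isomorphic G V W \<longleftrightarrow>
     (\<exists>\<phi> \<in> iso (add_monoid V) (add_monoid W).
        (\<forall>a. \<forall>x\<in>carrier V. \<phi> (a \<odot>\<^bsub>V\<^esub> x) = a \<odot>\<^bsub>W\<^esub> \<phi> x) \<and>
        (\<forall>g\<in>carrier G. \<forall>x\<in>carrier V. \<phi> (gact V g x) = gact W g (\<phi> x)))"

definition quotient_module :: "('g, 'v) cg_module \<Rightarrow> 'v set \<Rightarrow> ('g, 'v set) cg_module" where
  "quotient_module V U =
     \<lparr>carrier = a_rcosets\<^bsub>V\<^esub> U, monoid.mult = undefined, one = undefined, ring.zero = U,
      add = set_add V,
      module.smult = (\<lambda>a S. \<Union>x\<in>S. U +>\<^bsub>V\<^esub> (a \<odot>\<^bsub>V\<^esub> x)),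
      gact = (\<lambda>g S. gact V g ` S)\<rparr>"

text \<open>The tensor product of \<open>V\<close> with the one-dimensional module on which \<open>g\<close> acts as
  multiplication by the scalar \<open>\<chi> g\<close>, realised on the space of \<open>V\<close> by \<open>x \<otimes> a \<mapsto> a x\<close>;
  see \<open>tensor_character_universal\<close> and \<open>tensor_character_gact\<close> below.\<close>

definition tensor_character :: "('g, 'v) cg_module \<Rightarrow> ('g \<Rightarrow> complex) \<Rightarrow> ('g, 'v) cg_module" where
  "tensor_character V \<chi> = V\<lparr>gact := \<lambda>g x. \<chi> g \<odot>\<^bsub>V\<^esub> gact V g x\<rparr>"

definition sgn_character :: "('a \<Rightarrow> 'a) \<Rightarrow> complex" where
  "sgn_character p = of_int (sign p)"

lemma tensor_character_simps [simp]:
  "carrier (tensor_character V \<chi>) = carrier V"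
  "add (tensor_character V \<chi>) = add V"
  "ring.zero (tensor_character V \<chi>) = ring.zero V"
  "module.smult (tensor_character V \<chi>) = module.smult V"
  "gact (tensor_character V \<chi>) g x = \<chi> g \<odot>\<^bsub>V\<^esub> gact V g x"
  by (simp_all add: tensor_character_def)

lemma complex_ring_simps [simp]:
  "carrier (ring_of_type_algebra :: complex ring) = UNIV"
  "x \<oplus>\<^bsub>ring_of_type_algebra\<^esub> y = (x + y :: complex)"
  "x \<otimes>\<^bsub>ring_of_type_algebra\<^esub> y = (x * y :: complex)"
  "\<one>\<^bsub>ring_of_type_algebra\<^esub> = (1 :: complex)"
  "\<zero>\<^bsub>ring_of_type_algebra\<^esub> = (0 :: complex)"
  by (simp_all add: ring_of_type_algebra_def)

context cg_module
begin

lemma tensor_character_universal: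
  fixes W :: "('h, 'w) cg_module" and \<beta> :: "'v \<Rightarrow> complex \<Rightarrow> 'w"
  assumes add_left: "\<And>x y a. x \<in> carrier V \<Longrightarrow> y \<in> carrier V \<Longrightarrow>
      \<beta> (x \<oplus>\<^bsub>V\<^esub> y) a = \<beta> x a \<oplus>\<^bsub>W\<^esub> \<beta> y a"
    and smult_left: "\<And>x a b. x \<in> carrier V \<Longrightarrow> \<beta> (b \<odot>\<^bsub>V\<^esub> x) a = b \<odot>\<^bsub>W\<^esub> \<beta> x a"
    and smult_right: "\<And>x a b. x \<in> carrier V \<Longrightarrow> \<beta> x (b * a) = b \<odot>\<^bsub>W\<^esub> \<beta> x a"
  shows "\<exists>!f. f \<in> extensional (carrier V) \<and>
    (\<forall>x\<in>carrier V. \<forall>y\<in>carrier V. f (x \<oplus>\<^bsub>V\<^esub> y) = f x \<oplus>\<^bsub>W\<^esub> f y) \<and>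
    (\<forall>x\<in>carrier V. \<forall>a. f (a \<odot>\<^bsub>V\<^esub> x) = a \<odot>\<^bsub>W\<^esub> f x) \<and>
    (\<forall>x\<in>carrier V. \<forall>a. f (a \<odot>\<^bsub>V\<^esub> x) = \<beta> x a)"
proof (rule ex1I[of _ "\<lambda>x\<in>carrier V. \<beta> x 1"], intro conjI ballI allI)
  fix x a assume x: "x \<in> carrier V"
  have ax: "a \<odot>\<^bsub>V\<^esub> x \<in> carrier V"
    using smult_closed[of a x] x by simp
  show "(\<lambda>x\<in>carrier V. \<beta> x 1) (a \<odot>\<^bsub>V\<^esub> x) = a \<odot>\<^bsub>W\<^esub> (\<lambda>x\<in>carrier V. \<beta> x 1) x"
    using x ax by (simp add: smult_left)
  show "(\<lambda>x\<in>carrier V. \<beta> x 1) (a \<odot>\<^bsub>V\<^esub> x) = \<beta> x a"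
    using smult_left[OF x, of a 1] smult_right[OF x, of a 1] ax by simp
next
  fix x y assume "x \<in> carrier V" "y \<in> carrier V"
  then show "(\<lambda>x\<in>carrier V. \<beta> x 1) (x \<oplus>\<^bsub>V\<^esub> y) =
      (\<lambda>x\<in>carrier V. \<beta> x 1) x \<oplus>\<^bsub>W\<^esub> (\<lambda>x\<in>carrier V. \<beta> x 1) y"
    by (simp add: add_left)
next
  show "(\<lambda>x\<in>carrier V. \<beta> x 1) \<in> extensional (carrier V)" by simp
next
  fix f
  assume f: "f \<in> extensional (carrier V) \<and>
    (\<forall>x\<in>carrier V. \<forall>y\<in>carrier V. f (x \<oplus>\<^bsub>V\<^esub> y) = f x \<oplus>\<^bsub>W\<^esub> f y) \<and>
    (\<forall>x\<in>carrier V. \<forall>a. f (a \<odot>\<^bsub>V\<^esub> x) = a \<odot>\<^bsub>W\<^esub> f x) \<and>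
    (\<forall>x\<in>carrier V. \<forall>a. f (a \<odot>\<^bsub>V\<^esub> x) = \<beta> x a)"
  show "f = (\<lambda>x\<in>carrier V. \<beta> x 1)"
  proof (rule extensionalityI[where A = "carrier V"])
    fix x assume x: "x \<in> carrier V"
    then have "f (1 \<odot>\<^bsub>V\<^esub> x) = \<beta> x 1"
      using f by blast
    then show "f x = (\<lambda>x\<in>carrier V. \<beta> x 1) x"
      using x smult_one by simp
  qed (use f in auto)
qed

lemma tensor_character_gact:
  assumes "g \<in> carrier G" "x \<in> carrier V"
  shows "gact (tensor_character V \<chi>) g (a \<odot>\<^bsub>V\<^esub> x) = (\<chi> g * a) \<odot>\<^bsub>V\<^esub> gact V g x"
  using assms smult_assoc1[of "\<chi> g" a] by (simp add: gact_smult gact_closed)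

lemma cg_module_tensor_character:
  assumes "\<chi> \<one> = 1" "\<And>g h. g \<in> carrier G \<Longrightarrow> h \<in> carrier G \<Longrightarrow> \<chi> (g \<otimes> h) = \<chi> g * \<chi> h"
  shows "cg_module G (tensor_character V \<chi>)"
proof -
  have "abelian_group (tensor_character V \<chi>)"
    using M.abelian_group_axioms
    by (simp add: tensor_character_def abelian_group_def abelian_monoid_def
        abelian_group_axioms_def)
  moreover have "cg_module_axioms G (tensor_character V \<chi>)"
    by (unfold_locales; simp add: assms smult_r_distr gact_closed gact_add gact_smult gact_one
        gact_mult smult_assoc1[simplified, symmetric] smult_one[simplified] mult_ac)
  moreover have "module_axioms (ring_of_type_algebra :: complex ring) (tensor_character V \<chi>)"
    using module_axioms by (simp add: Module.module_def Module.module_axioms_def)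
  ultimately show ?thesis
    by (intro cg_module.intro module.intro group_axioms cring_from_type_algebra)
qed

lemma cg_module_restrict:
  assumes "additive_subgroup U V"
    and "\<And>a x. x \<in> U \<Longrightarrow> a \<odot>\<^bsub>V\<^esub> x \<in> U"
    and "\<And>g x. g \<in> carrier G \<Longrightarrow> x \<in> U \<Longrightarrow> gact V g x \<in> U"
  shows "cg_module G (V\<lparr>carrier := U\<rparr>)"
proof -
  interpret U: additive_subgroup U V by fact
  have sub: "x \<in> U \<Longrightarrow> x \<in> carrier V" for x
    using U.a_subset by blast
  have "abelian_group (V\<lparr>carrier := U\<rparr>)"
  proof (rule abelian_groupI)
    fix x assume "x \<in> carrier (V\<lparr>carrier := U\<rparr>)"
    then have "\<ominus>\<^bsub>V\<^esub> x \<in> U" "\<ominus>\<^bsub>V\<^esub> x \<oplus>\<^bsub>V\<^esub> x = \<zero>\<^bsub>V\<^esub>"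
      using sub M.l_neg by auto
    then show "\<exists>y\<in>carrier (V\<lparr>carrier := U\<rparr>). y \<oplus>\<^bsub>V\<lparr>carrier := U\<rparr>\<^esub> x = \<zero>\<^bsub>V\<lparr>carrier := U\<rparr>\<^esub>"
      by auto
  qed (use sub in \<open>auto simp: M.a_assoc intro: M.a_comm\<close>)
  moreover have "module_axioms (ring_of_type_algebra :: complex ring) (V\<lparr>carrier := U\<rparr>)"
    using module_axioms assms(2) sub by (simp add: Module.module_def Module.module_axioms_def)
  moreover have "cg_module_axioms G (V\<lparr>carrier := U\<rparr>)"
    using cg_module_axioms assms(3) sub unfolding cg_module_def cg_module_axioms_def by simp
  ultimately show ?thesis
    by (intro cg_module.intro module.intro group_axioms cring_from_type_algebra)
qed

lemma
  assumes U: "additive_subgroup U V"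
    and smult: "\<And>a x. x \<in> U \<Longrightarrow> a \<odot>\<^bsub>V\<^esub> x \<in> U"
    and gact: "\<And>g x. g \<in> carrier G \<Longrightarrow> x \<in> U \<Longrightarrow> gact V g x \<in> U"
  shows quotient_smult: "x \<in> carrier V \<Longrightarrow>
      a \<odot>\<^bsub>quotient_module V U\<^esub> (U +>\<^bsub>V\<^esub> x) = U +>\<^bsub>V\<^esub> (a \<odot>\<^bsub>V\<^esub> x)"
    and quotient_gact: "g \<in> carrier G \<Longrightarrow> x \<in> carrier V \<Longrightarrow>
      gact (quotient_module V U) g (U +>\<^bsub>V\<^esub> x) = U +>\<^bsub>V\<^esub> gact V g x"
    and cg_module_quotient: "cg_module G (quotient_module V U)"
proof -
  interpret U: abelian_subgroup U V
    using U M.abelian_group_axioms by (rule abelian_subgroupI3)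
  have sub: "x \<in> U \<Longrightarrow> x \<in> carrier V" for x
    using U.a_subset by blast
  have mem: "y \<in> U +>\<^bsub>V\<^esub> x \<longleftrightarrow> (\<exists>u\<in>U. y = u \<oplus>\<^bsub>V\<^esub> x)" for x y
    by (auto simp: a_r_coset_def')
  have shift: "U +>\<^bsub>V\<^esub> (u \<oplus>\<^bsub>V\<^esub> x) = U +>\<^bsub>V\<^esub> x" if "u \<in> U" "x \<in> carrier V" for u x
    using that M.a_coset_add_assoc[OF U.a_subset, of u x] sub
      M.a_coset_join2[OF _ U.a_subgroup, of u] by simp
  show sm: "a \<odot>\<^bsub>quotient_module V U\<^esub> (U +>\<^bsub>V\<^esub> x) = U +>\<^bsub>V\<^esub> (a \<odot>\<^bsub>V\<^esub> x)"
    if x: "x \<in> carrier V" for a x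
  proof -
    have eq: "U +>\<^bsub>V\<^esub> (a \<odot>\<^bsub>V\<^esub> y) = U +>\<^bsub>V\<^esub> (a \<odot>\<^bsub>V\<^esub> x)" if "y \<in> U +>\<^bsub>V\<^esub> x" for y
    proof -
      from that have "\<exists>u\<in>U. y = u \<oplus>\<^bsub>V\<^esub> x"
        unfolding mem .
      then obtain u where u: "u \<in> U" "y = u \<oplus>\<^bsub>V\<^esub> x" by blast
      then have "a \<odot>\<^bsub>V\<^esub> y = (a \<odot>\<^bsub>V\<^esub> u) \<oplus>\<^bsub>V\<^esub> (a \<odot>\<^bsub>V\<^esub> x)"
        using x sub smult_r_distr[of a u x] by simp
      then show ?thesis
        using shift[OF smult[OF u(1)], of "a \<odot>\<^bsub>V\<^esub> x"] smult_closed[of a x] x by simp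
    qed
    have "(\<Union>y\<in>U +>\<^bsub>V\<^esub> x. U +>\<^bsub>V\<^esub> (a \<odot>\<^bsub>V\<^esub> y)) = U +>\<^bsub>V\<^esub> (a \<odot>\<^bsub>V\<^esub> x)"
      by (rule UN_constant_eq[OF U.a_rcos_self[OF x]]) (rule ballI, rule eq)
    then show ?thesis
      by (simp add: quotient_module_def)
  qed
  show ga: "gact (quotient_module V U) g (U +>\<^bsub>V\<^esub> x) = U +>\<^bsub>V\<^esub> gact V g x"
    if g: "g \<in> carrier G" and x: "x \<in> carrier V" for g x
  proof (rule Set.set_eqI)
    fix y
    have inv: "\<exists>w\<in>U. u = gact V g w" if "u \<in> U" for u
    proof
      show "u = gact V g (gact V (inv\<^bsub>G\<^esub> g) u)"
        using that g sub gact_mult[of g "inv\<^bsub>G\<^esub> g" u] gact_one by simp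
      show "gact V (inv\<^bsub>G\<^esub> g) u \<in> U"
        using that g by (intro gact) simp_all
    qed
    have "U +>\<^bsub>V\<^esub> x = (\<lambda>u. u \<oplus>\<^bsub>V\<^esub> x) ` U"
      by (auto simp: a_r_coset_def')
    then have "y \<in> gact (quotient_module V U) g (U +>\<^bsub>V\<^esub> x) \<longleftrightarrow>
        (\<exists>u\<in>U. y = gact V g (u \<oplus>\<^bsub>V\<^esub> x))"
      by (auto simp: quotient_module_def)
    also have "\<dots> \<longleftrightarrow> (\<exists>u\<in>U. y = gact V g u \<oplus>\<^bsub>V\<^esub> gact V g x)"
      using gact_add[OF g sub x] by (intro bex_cong) simp_all
    also have "\<dots> \<longleftrightarrow> (\<exists>u\<in>U. y = u \<oplus>\<^bsub>V\<^esub> gact V g x)"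
      using inv gact[OF g] by blast
    finally show "y \<in> gact (quotient_module V U) g (U +>\<^bsub>V\<^esub> x) \<longleftrightarrow> y \<in> U +>\<^bsub>V\<^esub> gact V g x"
      unfolding mem .
  qed
  have carI: "U +>\<^bsub>V\<^esub> x \<in> carrier (quotient_module V U)" if "x \<in> carrier V" for x
    using that by (auto simp: quotient_module_def A_RCOSETS_def')
  have carE: thesis if "S \<in> carrier (quotient_module V U)"
    "\<And>x. x \<in> carrier V \<Longrightarrow> S = U +>\<^bsub>V\<^esub> x \<Longrightarrow> thesis" for S thesis
    using that by (auto simp: quotient_module_def A_RCOSETS_def')
  have ad: "(U +>\<^bsub>V\<^esub> x) \<oplus>\<^bsub>quotient_module V U\<^esub> (U +>\<^bsub>V\<^esub> y) = U +>\<^bsub>V\<^esub> (x \<oplus>\<^bsub>V\<^esub> y)"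
    if "x \<in> carrier V" "y \<in> carrier V" for x y
    using that by (simp add: quotient_module_def U.a_rcos_sum)
  have ze: "\<zero>\<^bsub>quotient_module V U\<^esub> = U +>\<^bsub>V\<^esub> \<zero>\<^bsub>V\<^esub>"
    using M.a_coset_add_zero[OF U.a_subset] by (simp add: quotient_module_def)
  have "abelian_group (quotient_module V U)"
  proof (rule abelian_groupI)
    fix S assume "S \<in> carrier (quotient_module V U)"
    then show "\<exists>T\<in>carrier (quotient_module V U). T \<oplus>\<^bsub>quotient_module V U\<^esub> S =
        \<zero>\<^bsub>quotient_module V U\<^esub>"
    proof (rule carE)
      fix x assume x: "x \<in> carrier V" "S = U +>\<^bsub>V\<^esub> x"
      then have "(U +>\<^bsub>V\<^esub> (\<ominus>\<^bsub>V\<^esub> x)) \<oplus>\<^bsub>quotient_module V U\<^esub> S = \<zero>\<^bsub>quotient_module V U\<^esub>"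
        by (simp add: ad ze M.l_neg)
      then show ?thesis
        using carI[of "\<ominus>\<^bsub>V\<^esub> x"] x(1) by blast
    qed
  qed (elim carE; simp add: ad ze carI M.a_assoc; simp add: M.a_comm | simp add: ze carI)+
  moreover have "module_axioms (ring_of_type_algebra :: complex ring) (quotient_module V U)"
    by (unfold_locales; (elim carE)?;
        simp add: ad sm carI smult_closed[simplified] smult_l_distr[simplified] smult_r_distr
          smult_assoc1[simplified] smult_one[simplified])
  moreover have "cg_module_axioms G (quotient_module V U)"
    by (unfold_locales; (elim carE)?;
        simp add: ad sm ga carI smult_closed[simplified] gact_closed gact_add gact_smult gact_one
          gact_mult)
  ultimately show "cg_module G (quotient_module V U)"
    by (intro cg_module.intro module.intro group_axioms cring_from_type_algebra)
qed

end


section \<open>Matroids\<close>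

record 'a set_system =
  ground :: "'a set"
  indep :: "'a set set"

locale matroid =
  fixes M :: "'a set_system"
  assumes finite_ground: "finite (ground M)"
    and indep_subset: "I \<in> indep M \<Longrightarrow> I \<subseteq> ground M"
    and empty_indep: "{} \<in> indep M"
    and indep_hereditary: "I \<in> indep M \<Longrightarrow> J \<subseteq> I \<Longrightarrow> J \<in> indep M"
    and augmentation: "I \<in> indep M \<Longrightarrow> J \<in> indep M \<Longrightarrow> card I < card J \<Longrightarrow>
      \<exists>x\<in>J - I. insert x I \<in> indep M"

definition rk :: "'a set_system \<Rightarrow> 'a set \<Rightarrow> nat" where
  "rk M A = Max (card ` {I \<in> indep M. I \<subseteq> A})"

definition bases :: "'a set_system \<Rightarrow> 'a set set" where
  "bases M = {B \<in> indep M. \<forall>I\<in>indep M. B \<subseteq> I \<longrightarrow> I = B}"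

definition dual :: "'a set_system \<Rightarrow> 'a set_system" where
  "dual M = \<lparr>ground = ground M, indep = {I. \<exists>B\<in>bases M. I \<subseteq> ground M - B}\<rparr>"

definition IN :: "'a set_system \<Rightarrow> 'a set set" where
  "IN M = indep M"

definition NS :: "'a set_system \<Rightarrow> 'a set set" where
  "NS M = {A. A \<subseteq> ground M \<and> rk M A < rk M (ground M)}"

definition aut_group :: "'a set_system \<Rightarrow> ('a \<Rightarrow> 'a) monoid" where
  "aut_group M =
     \<lparr>carrier = {p. p permutes ground M \<and> (\<forall>A\<subseteq>ground M. p ` A \<in> indep M \<longleftrightarrow> A \<in> indep M)},
      monoid.mult = (\<circ>), one = id\<rparr>"


section \<open>Reduced simplicial homology\<close>

text \<open>A complex is given by its set \<open>K\<close> of faces, the empty face included.  The oriented simplex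
  \<open>[j\<^sub>1, \<dots>, j\<^sub>k]\<close> is encoded as the alternating function on lists which takes the value \<open>sign p\<close>
  on the rearrangement of \<open>j\<^sub>1, \<dots>, j\<^sub>k\<close> by \<open>p\<close> and vanishes elsewhere.  The space of
  \<open>d\<close>-chains is thus the space of alternating functions supported on the orderings of the
  \<open>d\<close>-dimensional faces.  The lemmas \<open>osimplex_permute\<close>, \<open>chain_expansion\<close>,
  \<open>boundary_osimplex\<close> and \<open>gact_osimplex\<close> below give the usual description in terms of oriented
  simplices.  Degree \<open>-1\<close> is spanned by the empty simplex.\<close>

definition osimplex :: "'a list \<Rightarrow> 'a list \<Rightarrow> complex" where
  "osimplex js xs =
     (\<Sum>p | p permutes {..<length js} \<and> permute_list p js = xs. of_int (sign p))"

definition alternating :: "('a list \<Rightarrow> complex) \<Rightarrow> bool" where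
  "alternating c \<longleftrightarrow> (\<forall>xs p. p permutes {..<length xs} \<longrightarrow>
     c (permute_list p xs) = of_int (sign p) * c xs)"

definition ordered_faces :: "'a set set \<Rightarrow> int \<Rightarrow> 'a list set" where
  "ordered_faces K d = {xs. distinct xs \<and> set xs \<in> K \<and> int (length xs) = d + 1}"

definition simplicial_chains ::
    "'a set set \<Rightarrow> int \<Rightarrow> ('a \<Rightarrow> 'a, 'a list \<Rightarrow> complex) cg_module" where
  "simplicial_chains K d =
     \<lparr>carrier = {c. alternating c \<and> (\<forall>xs. xs \<notin> ordered_faces K d \<longrightarrow> c xs = 0)},
      monoid.mult = undefined, one = undefined,
      ring.zero = (\<lambda>xs. 0), add = (\<lambda>b c xs. b xs + c xs),
      module.smult = (\<lambda>a c xs. a * c xs),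
      gact = (\<lambda>g c xs. c (map (Hilbert_Choice.inv g) xs))\<rparr>"

definition boundary :: "'a set set \<Rightarrow> ('a list \<Rightarrow> complex) \<Rightarrow> 'a list \<Rightarrow> complex" where
  "boundary K c xs = (\<Sum>v\<in>\<Union>K. c (v # xs))"

definition cycles :: "'a set set \<Rightarrow> int \<Rightarrow> ('a list \<Rightarrow> complex) set" where
  "cycles K d = {c \<in> carrier (simplicial_chains K d). boundary K c = (\<lambda>xs. 0)}"

definition boundaries :: "'a set set \<Rightarrow> int \<Rightarrow> ('a list \<Rightarrow> complex) set" where
  "boundaries K d = boundary K ` carrier (simplicial_chains K (d + 1))"

definition reduced_homology ::
    "'a set set \<Rightarrow> int \<Rightarrow> ('a \<Rightarrow> 'a, ('a list \<Rightarrow> complex) set) cg_module" where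
  "reduced_homology K d =
     quotient_module ((simplicial_chains K d)\<lparr>carrier := cycles K d\<rparr>) (boundaries K d)"

lemma sign_permute_compose:
  assumes "p permutes {..<n}" "q permutes {..<n :: nat}"
  shows "sign (p \<circ> q) = sign p * sign q"
  using assms by (intro sign_compose permutation_permutes[THEN iffD2]) auto

lemma permute_list_inj:
  assumes "distinct js" "p permutes {..<length js}" "q permutes {..<length js}"
    and "permute_list p js = permute_list q js"
  shows "p = q"
proof (rule ext)
  fix i
  show "p i = q i"
  proof (cases "i < length js")
    case True
    then have "js ! p i = js ! q i"
      using assms by (metis permute_list_nth)
    moreover have "p i < length js" "q i < length js"
      using assms(2,3) True permutes_in_image by fastforce+
    ultimately show ?thesis
      using assms(1) nth_eq_iff_index_eq by blast
  next
    case False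
    then show ?thesis
      using assms(2,3) by (simp add: permutes_def)
  qed
qed

lemma osimplex_apply:
  assumes "distinct js" "p permutes {..<length js}"
  shows "osimplex js (permute_list p js) = of_int (sign p)"
proof -
  have "{q. q permutes {..<length js} \<and> permute_list q js = permute_list p js} = {p}"
    using permute_list_inj[OF assms(1) _ assms(2)] assms(2) by auto
  then show ?thesis
    by (simp add: osimplex_def)
qed

lemma osimplex_self: "distinct js \<Longrightarrow> osimplex js js = 1"
  using osimplex_apply[of js id] by (simp add: permutes_id)

lemma osimplex_eq_0:
  assumes "mset xs \<noteq> mset js"
  shows "osimplex js xs = 0"
proof -
  have "{q. q permutes {..<length js} \<and> permute_list q js = xs} = {}"
    using assms by auto
  then show ?thesis
    unfolding osimplex_def by (metis (lifting) sum.empty)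
qed

lemma osimplex_cases:
  assumes "distinct js"
  obtains (perm) p where "p permutes {..<length js}" "xs = permute_list p js"
      "osimplex js xs = of_int (sign p)"
    | (zero) "mset xs \<noteq> mset js" "osimplex js xs = 0"
  using osimplex_apply[OF assms] osimplex_eq_0 mset_eq_permutation by metis

lemma osimplex_permute:
  assumes "distinct js" "q permutes {..<length js}"
  shows "osimplex (permute_list q js) xs = of_int (sign q) * osimplex js xs"
proof (cases rule: osimplex_cases[OF assms(1), of xs, case_names perm zero])
  case (perm p)
  define r where "r = Hilbert_Choice.inv q \<circ> p"
  have r: "r permutes {..<length js}"
    unfolding r_def using assms perm by (intro permutes_compose permutes_inv)
  have "q \<circ> r = p"
    unfolding r_def using assms(2) by (simp add: o_assoc permutes_inv_o)
  then have "xs = permute_list r (permute_list q js)"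
    using perm(2) permute_list_compose[OF r] by metis
  then have "osimplex (permute_list q js) xs = of_int (sign r)"
    using osimplex_apply[of "permute_list q js" r] assms r by simp
  moreover have "sign q * sign r = sign p"
    using sign_permute_compose[OF assms(2) r] \<open>q \<circ> r = p\<close> by simp
  then have "sign r = sign q * sign p"
    by (metis mult.assoc mult_1 sign_idempotent)
  ultimately show ?thesis
    using perm by simp
next
  case zero
  then show ?thesis
    using assms by (simp add: osimplex_eq_0)
qed

lemma alternating_osimplex:
  assumes "distinct js"
  shows "alternating (osimplex js)"
  unfolding alternating_def
proof (intro allI impI)
  fix xs :: "'a list" and q assume q: "q permutes {..<length xs}"
  show "osimplex js (permute_list q xs) = of_int (sign q) * osimplex js xs"
  proof (cases rule: osimplex_cases[OF assms, of xs, case_names perm zero])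
    case (perm p)
    then have q': "q permutes {..<length js}"
      using q by simp
    have "permute_list q xs = permute_list (p \<circ> q) js"
      using perm permute_list_compose[OF q'] by simp
    then have "osimplex js (permute_list q xs) = of_int (sign (p \<circ> q))"
      using osimplex_apply[OF assms permutes_compose[OF q' perm(1)]] by simp
    then show ?thesis
      using perm sign_permute_compose[OF perm(1) q'] by simp
  next
    case zero
    then show ?thesis
      using q by (simp add: osimplex_eq_0)
  qed
qed

lemma osimplex_in_chains:
  assumes "js \<in> ordered_faces K d"
  shows "osimplex js \<in> carrier (simplicial_chains K d)"
proof -
  have js: "distinct js" "set js \<in> K" "int (length js) = d + 1"
    using assms by (auto simp: ordered_faces_def)
  have "osimplex js xs = 0" if "xs \<notin> ordered_faces K d" for xs
  proof (rule osimplex_eq_0, rule notI)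
    assume "mset xs = mset js"
    then have "distinct xs" "set xs = set js" "length xs = length js"
      using js(1) mset_eq_imp_distinct_iff mset_eq_setD mset_eq_length by blast+
    then show False
      using that js by (simp add: ordered_faces_def)
  qed
  then show ?thesis
    using alternating_osimplex[OF js(1)] by (simp add: simplicial_chains_def)
qed

lemma finite_ordered_faces:
  assumes "finite (\<Union>K)"
  shows "finite (ordered_faces K d)"
proof (rule finite_subset)
  show "ordered_faces K d \<subseteq> {xs. set xs \<subseteq> \<Union>K \<and> length xs = nat (d + 1)}"
    by (auto simp: ordered_faces_def)
  show "finite {xs. set xs \<subseteq> \<Union>K \<and> length xs = nat (d + 1)}"
    by (rule finite_lists_length_eq[OF assms])
qed

lemma chain_expansion:
  assumes fin: "finite (\<Union>K)" and c: "c \<in> carrier (simplicial_chains K d)"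
  shows "c xs = (\<Sum>js\<in>ordered_faces K d. c js / fact (length js) * osimplex js xs)"
proof -
  let ?P = "\<lambda>n. {p. p permutes {..<n :: nat}}"
  have alt: "alternating c" and supp: "\<And>xs. xs \<notin> ordered_faces K d \<Longrightarrow> c xs = 0"
    using c by (auto simp: simplicial_chains_def)
  define n where "n = nat (d + 1)"
  have len: "length js = n" if "js \<in> ordered_faces K d" for js
    using that by (auto simp: ordered_faces_def n_def)
  have finP: "finite (?P n)"
    by (simp add: finite_permutations)
  note finF = finite_ordered_faces[OF fin, of d]
  have "(\<Sum>js\<in>ordered_faces K d. c js * osimplex js xs) =
      (\<Sum>js\<in>ordered_faces K d. \<Sum>p\<in>?P n. if permute_list p js = xs then c js * of_int (sign p) else 0)"
  proof (rule sum.cong)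
    fix js assume js: "js \<in> ordered_faces K d"
    have "c js * osimplex js xs =
        (\<Sum>p\<in>{p \<in> ?P n. permute_list p js = xs}. c js * of_int (sign p))"
      by (simp add: osimplex_def len[OF js] sum_distrib_left)
    also have "\<dots> = (\<Sum>p\<in>?P n. if permute_list p js = xs then c js * of_int (sign p) else 0)"
      by (rule sum.inter_filter[OF finP])
    finally show "c js * osimplex js xs = \<dots>" .
  qed simp
  also have "\<dots> = (\<Sum>p\<in>?P n. \<Sum>js\<in>ordered_faces K d.
      if permute_list p js = xs then c js * of_int (sign p) else 0)"
    by (rule sum.swap)
  also have "\<dots> = (\<Sum>p\<in>?P n. c xs)"
  proof (rule sum.cong)
    fix p assume "p \<in> ?P n"
    then have p: "p permutes {..<n}" by simp
    let ?q = "Hilbert_Choice.inv p"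
    have q: "?q permutes {..<n}" using p by (rule permutes_inv)
    show "(\<Sum>js\<in>ordered_faces K d. if permute_list p js = xs then c js * of_int (sign p) else 0)
        = c xs"
    proof (cases "xs \<in> ordered_faces K d")
      case True
      let ?js = "permute_list ?q xs"
      have qx: "?q permutes {..<length xs}" and px: "p permutes {..<length xs}"
        using p q len[OF True] by simp_all
      have js: "?js \<in> ordered_faces K d"
        using True qx by (simp add: ordered_faces_def)
      have "permute_list p js = xs \<longleftrightarrow> js = ?js" if "js \<in> ordered_faces K d" for js
      proof -
        have pj: "p permutes {..<length js}" "?q permutes {..<length js}"
          using p q len[OF that] by simp_all
        have "permute_list p ?js = xs"
          using permute_list_compose[OF px, of ?q] p by (simp add: permutes_inv_o)
        moreover have "permute_list ?q (permute_list p js) = js"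
          using permute_list_compose[OF pj(2), of p] p by (simp add: permutes_inv_o)
        ultimately show ?thesis by auto
      qed
      then have "(\<Sum>js\<in>ordered_faces K d. if permute_list p js = xs then c js * of_int (sign p) else 0)
          = (\<Sum>js\<in>ordered_faces K d. if js = ?js then c js * of_int (sign p) else 0)"
        by (intro sum.cong) auto
      also have "\<dots> = c ?js * of_int (sign p)"
        using js by (simp add: sum.delta[OF finF])
      also have "\<dots> = of_int (sign p * sign p) * c xs"
      proof -
        have "permutation p"
          using p by (intro permutation_permutes[THEN iffD2]) auto
        then have "c ?js = of_int (sign p) * c xs"
          using alt[unfolded alternating_def, rule_format, OF qx] by (simp add: sign_inverse)
        then show ?thesis
          by (simp only: of_int_mult mult_ac)
      qed
      finally show ?thesis
        by simp
    next
      case False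
      have "permute_list p js \<noteq> xs" if "js \<in> ordered_faces K d" for js
      proof
        assume "permute_list p js = xs"
        moreover have "p permutes {..<length js}"
          using p len[OF that] by simp
        ultimately have "distinct xs" "set xs = set js" "length xs = length js"
          using that by (auto simp: ordered_faces_def)
        then show False
          using False that by (simp add: ordered_faces_def)
      qed
      then show ?thesis
        using supp[OF False] by (auto intro!: sum.neutral)
    qed
  qed simp
  also have "\<dots> = fact n * c xs"
    using card_permutations[of "{..<n}" n] by simp
  finally have "fact n * c xs = (\<Sum>js\<in>ordered_faces K d. c js * osimplex js xs)" ..
  moreover have "(\<Sum>js\<in>ordered_faces K d. c js / fact (length js) * osimplex js xs) =
      (\<Sum>js\<in>ordered_faces K d. c js * osimplex js xs) / fact n"
    unfolding sum_divide_distrib by (intro sum.cong) (auto simp: len)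
  ultimately show ?thesis
    by (metis fact_nonzero nonzero_mult_div_cancel_left)
qed

lemma permute_list_Cons_lift:
  assumes "p permutes {..<length xs}"
  obtains p' where "p' permutes {..<Suc (length xs)}" "sign p' = sign p"
    "\<And>v. permute_list p' (v # xs) = v # permute_list p xs"
proof
  let ?n = "length xs"
  define p' where "p' = map_permutation {..<?n} Suc p"
  have "p' permutes Suc ` {..<?n}"
    unfolding p'_def by (rule map_permutation_permutes) (use assms in auto)
  then show p': "p' permutes {..<Suc ?n}"
    by (rule permutes_subset) auto
  show "sign p' = sign p"
    unfolding p'_def by (rule sign_map_permutation) (use assms in auto)
  have "p' 0 = 0"
    using \<open>p' permutes Suc ` {..<?n}\<close> by (rule permutes_not_in) auto
  moreover have "p' (Suc i) = Suc (p i)" if "i < ?n" for i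
    unfolding p'_def by (rule map_permutation_apply) (use that in auto)
  ultimately show "permute_list p' (v # xs) = v # permute_list p xs" for v
    using p' assms
    by (intro nth_equalityI) (auto simp: permute_list_nth nth_Cons' less_Suc_eq_0_disj)
qed

lemma osimplex_Cons_Cons:
  assumes "distinct (v # zs)"
  shows "osimplex (v # zs) (v # ys) = osimplex zs ys"
proof -
  have "distinct zs" using assms by simp
  show ?thesis
  proof (cases rule: osimplex_cases[OF \<open>distinct zs\<close>, of ys, case_names perm zero])
    case (perm p)
    obtain p' where p': "p' permutes {..<Suc (length zs)}" "sign p' = sign p"
        "permute_list p' (v # zs) = v # permute_list p zs"
      using permute_list_Cons_lift[OF perm(1)] by metis
    then show ?thesis
      using osimplex_apply[OF assms, of p'] perm by simp
  next
    case zero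
    then show ?thesis
      by (simp add: osimplex_eq_0)
  qed
qed

lemma permute_to_front:
  assumes "i < length js"
  shows "\<exists>p. p permutes {..<length js} \<and> sign p = (- 1) ^ i \<and>
    permute_list p js = js ! i # take i js @ drop (Suc i) js"
  using assms
proof (induction i arbitrary: js)
  case 0
  then show ?case
    by (intro exI[of _ id]) (auto simp: permutes_def Cons_nth_drop_Suc neq_Nil_conv)
next
  case (Suc i)
  define t where "t = transpose i (Suc i)"
  have t: "t permutes {..<length js}"
    unfolding t_def using Suc.prems by (intro permutes_swap_id) auto
  define js' where "js' = permute_list t js"
  have len: "length js' = length js"
    by (simp add: js'_def)
  have nth: "js' ! k = js ! t k" if "k < length js" for k
    unfolding js'_def using t that by (rule permute_list_nth)
  obtain p where p: "p permutes {..<length js}" "sign p = (- 1) ^ i"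
      "permute_list p js' = js' ! i # take i js' @ drop (Suc i) js'"
    using Suc.IH[of js'] Suc.prems len by auto
  have "js' ! i = js ! Suc i"
    using Suc.prems by (simp add: nth t_def)
  moreover have "take i js' @ drop (Suc i) js' = take (Suc i) js @ drop (Suc (Suc i)) js"
  proof (rule nth_equalityI)
    fix k assume k: "k < length (take i js' @ drop (Suc i) js')"
    consider "k < i" | "k = i" | "k > i" by linarith
    then show "(take i js' @ drop (Suc i) js') ! k = (take (Suc i) js @ drop (Suc (Suc i)) js) ! k"
      by cases (use k Suc.prems len in
        \<open>auto simp: nth_append nth min_def t_def transpose_def\<close>)
  qed (use Suc.prems len in auto)
  moreover have "permute_list (t \<circ> p) js = permute_list p js'"
    unfolding js'_def by (rule permute_list_compose[OF p(1)])
  moreover have "sign (t \<circ> p) = (- 1) ^ Suc i"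
    using sign_permute_compose[OF t p(1)] p(2) by (simp add: t_def sign_swap_id)
  ultimately show ?case
    using p permutes_compose[OF p(1) t] by metis
qed

lemma boundary_osimplex:
  assumes fin: "finite (\<Union>K)" and js: "distinct js" "set js \<subseteq> \<Union>K"
  shows "boundary K (osimplex js) ys =
    (\<Sum>i<length js. (- 1) ^ i * osimplex (take i js @ drop (Suc i) js) ys)"
proof -
  have "boundary K (osimplex js) ys = (\<Sum>v\<in>set js. osimplex js (v # ys))"
    unfolding boundary_def
  proof (rule sum.mono_neutral_right[OF fin js(2)])
    show "\<forall>v\<in>\<Union>K - set js. osimplex js (v # ys) = 0"
      by (metis DiffD2 list.set_intros(1) mset_eq_setD osimplex_eq_0)
  qed
  also have "\<dots> = (\<Sum>i<length js. osimplex js (js ! i # ys))"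
    using bij_betw_nth[OF js(1) refl refl]
    by (intro sum.reindex_bij_betw[symmetric]) auto
  also have "\<dots> = (\<Sum>i<length js. (- 1) ^ i * osimplex (take i js @ drop (Suc i) js) ys)"
  proof (rule sum.cong)
    fix i assume "i \<in> {..<length js}"
    then obtain p where p: "p permutes {..<length js}" "sign p = (- 1) ^ i"
        "permute_list p js = js ! i # take i js @ drop (Suc i) js"
      using permute_to_front by auto
    have "distinct (js ! i # take i js @ drop (Suc i) js)"
      using p js(1) by (metis distinct_permute_list)
    then have "osimplex (take i js @ drop (Suc i) js) ys = osimplex (permute_list p js) (js ! i # ys)"
      by (simp add: p(3) osimplex_Cons_Cons)
    also have "\<dots> = (- 1) ^ i * osimplex js (js ! i # ys)"
      using osimplex_permute[OF js(1) p(1)] p(2) by simp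
    finally show "osimplex js (js ! i # ys) =
        (- 1) ^ i * osimplex (take i js @ drop (Suc i) js) ys"
      by simp
  qed simp
  finally show ?thesis .
qed

lemma gact_osimplex:
  assumes "bij g"
  shows "gact (simplicial_chains K d) g (osimplex js) = osimplex (map g js)"
proof (rule ext)
  fix xs
  have "permute_list p js = map (Hilbert_Choice.inv g) xs \<longleftrightarrow> permute_list p (map g js) = xs"
    if "p permutes {..<length js}" for p
    using assms permute_list_map[OF that, of g]
    by (auto simp: bij_is_inj bij_is_surj surj_f_inv_f o_def map_idI)
  then show "gact (simplicial_chains K d) g (osimplex js) xs = osimplex (map g js) xs"
    unfolding simplicial_chains_def osimplex_def by (auto intro!: sum.cong)
qed

lemma simplicial_chains_simps [simp]:
  "\<zero>\<^bsub>simplicial_chains K d\<^esub> = (\<lambda>xs. 0)"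
  "b \<oplus>\<^bsub>simplicial_chains K d\<^esub> c = (\<lambda>xs. b xs + c xs)"
  "a \<odot>\<^bsub>simplicial_chains K d\<^esub> c = (\<lambda>xs. a * c xs)"
  "gact (simplicial_chains K d) g c = (\<lambda>xs. c (map (Hilbert_Choice.inv g) xs))"
  by (simp_all add: simplicial_chains_def)

lemma simplicial_chainsI:
  assumes "alternating c" "\<And>xs. xs \<notin> ordered_faces K d \<Longrightarrow> c xs = 0"
  shows "c \<in> carrier (simplicial_chains K d)"
  using assms by (simp add: simplicial_chains_def)

lemma simplicial_chainsD:
  assumes "c \<in> carrier (simplicial_chains K d)"
  shows "alternating c" "xs \<notin> ordered_faces K d \<Longrightarrow> c xs = 0"
  using assms by (simp_all add: simplicial_chains_def)

lemma abelian_group_simplicial_chains: "abelian_group (simplicial_chains K d)"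
proof (rule abelian_groupI)
  fix c assume "c \<in> carrier (simplicial_chains K d)"
  then have "(\<lambda>xs. - c xs) \<in> carrier (simplicial_chains K d)"
    by (auto simp: simplicial_chains_def alternating_def)
  then show "\<exists>b\<in>carrier (simplicial_chains K d).
      b \<oplus>\<^bsub>simplicial_chains K d\<^esub> c = \<zero>\<^bsub>simplicial_chains K d\<^esub>"
    by force
qed (auto simp: simplicial_chains_def alternating_def algebra_simps)

lemma boundary_in_cycles:
  assumes fin: "finite (\<Union>K)" and down: "\<And>A B. A \<in> K \<Longrightarrow> B \<subseteq> A \<Longrightarrow> B \<in> K"
    and c: "c \<in> carrier (simplicial_chains K (d + 1))"
  shows "boundary K c \<in> cycles K d"
proof -
  note alt = simplicial_chainsD(1)[OF c, unfolded alternating_def, rule_format]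
  have "alternating (boundary K c)"
    unfolding alternating_def
  proof (intro allI impI)
    fix xs :: "'a list" and p assume "p permutes {..<length xs}"
    then obtain p' where p': "p' permutes {..<Suc (length xs)}" "sign p' = sign p"
        "\<And>v. permute_list p' (v # xs) = v # permute_list p xs"
      using permute_list_Cons_lift[of p xs thesis] by blast
    then have "c (v # permute_list p xs) = of_int (sign p) * c (v # xs)" for v
      using alt[of p' "v # xs"] by simp
    then show "boundary K c (permute_list p xs) = of_int (sign p) * boundary K c xs"
      by (simp add: boundary_def sum_distrib_left)
  qed
  moreover have "boundary K c xs = 0" if "xs \<notin> ordered_faces K d" for xs
  proof -
    have "v # xs \<notin> ordered_faces K (d + 1)" for v
      using that down[of "set (v # xs)" "set xs"] by (auto simp: ordered_faces_def)
    then show ?thesis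
      unfolding boundary_def using simplicial_chainsD(2)[OF c] by (meson sum.neutral)
  qed
  moreover have "boundary K (boundary K c) xs = 0" for xs
  proof -
    have anti: "c (v # w # xs) = - c (w # v # xs)" for v w
    proof -
      let ?t = "transpose 0 (1 :: nat)"
      have t: "?t permutes {..<length (w # v # xs)}"
        by (intro permutes_swap_id) auto
      have "permute_list ?t (w # v # xs) = v # w # xs"
      proof (rule nth_equalityI)
        fix k assume "k < length (permute_list ?t (w # v # xs))"
        then show "permute_list ?t (w # v # xs) ! k = (v # w # xs) ! k"
          using permute_list_nth[OF t, of k] by (auto simp: transpose_def nth_Cons' split: if_splits)
      qed simp
      then show ?thesis
        using alt[OF t] by (simp add: sign_swap_id)
    qed
    let ?S = "\<Sum>v\<in>\<Union>K. \<Sum>w\<in>\<Union>K. c (w # v # xs)"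
    have "?S = (\<Sum>v\<in>\<Union>K. \<Sum>w\<in>\<Union>K. c (v # w # xs))"
      by (rule sum.swap)
    also have "\<dots> = - ?S"
      by (subst anti) (simp add: sum_negf)
    finally show ?thesis
      by (simp add: boundary_def)
  qed
  ultimately show ?thesis
    by (auto simp: cycles_def intro: simplicial_chainsI)
qed

lemma boundary_gact:
  assumes bij: "bij g" and K: "g ` \<Union>K = \<Union>K"
  shows "boundary K (gact (simplicial_chains K d) g c) = gact (simplicial_chains K e) g (boundary K c)"
proof (rule ext)
  fix xs
  let ?h = "Hilbert_Choice.inv g"
  have "bij_betw ?h (\<Union>K) (\<Union>K)"
    using bij_betw_subset[OF bij_imp_bij_inv[OF bij], of "\<Union>K" "\<Union>K"] K bij
    by (metis bij_is_inj image_inv_f_f subset_UNIV)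
  then have "(\<Sum>v\<in>\<Union>K. c (?h v # map ?h xs)) = (\<Sum>v\<in>\<Union>K. c (v # map ?h xs))"
    by (rule sum.reindex_bij_betw)
  then show "boundary K (gact (simplicial_chains K d) g c) xs =
      gact (simplicial_chains K e) g (boundary K c) xs"
    by (simp add: boundary_def)
qed

lemma cg_module_simplicial_chains:
  fixes G :: "('a \<Rightarrow> 'a, 'r) monoid_scheme"
  assumes G: "group G" "monoid.mult G = (\<circ>)" "\<one>\<^bsub>G\<^esub> = id" "\<And>g. g \<in> carrier G \<Longrightarrow> bij g"
    and K: "\<And>g A. g \<in> carrier G \<Longrightarrow> g ` A \<in> K \<longleftrightarrow> A \<in> K"
  shows "cg_module G (simplicial_chains K d)"
proof -
  interpret G: group G by fact
  have "gact (simplicial_chains K d) g c \<in> carrier (simplicial_chains K d)"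
    if g: "g \<in> carrier G" and c: "c \<in> carrier (simplicial_chains K d)" for g c
  proof (rule simplicial_chainsI)
    let ?h = "Hilbert_Choice.inv g"
    have bij: "bij g"
      using G(4) g .
    show "alternating (gact (simplicial_chains K d) g c)"
      using simplicial_chainsD(1)[OF c]
      by (auto simp: alternating_def simp flip: permute_list_map)
    fix xs assume xs: "xs \<notin> ordered_faces K d"
    have "set xs = g ` set (map ?h xs)"
      using bij by (simp add: image_image bij_is_surj surj_f_inv_f)
    moreover have "distinct (map ?h xs) \<longleftrightarrow> distinct xs"
      using bij by (metis bij_imp_bij_inv bij_is_inj distinct_map inj_on_subset subset_UNIV)
    ultimately have "map ?h xs \<notin> ordered_faces K d"
      using xs K[OF g, of "set (map ?h xs)"] by (auto simp: ordered_faces_def)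
    then show "gact (simplicial_chains K d) g c xs = 0"
      using simplicial_chainsD(2)[OF c] by simp
  qed
  moreover have "gact (simplicial_chains K d) (g \<circ> h) c =
      gact (simplicial_chains K d) g (gact (simplicial_chains K d) h c)"
    if "bij g" "bij h" for g h c
    using that by (simp add: o_inv_distrib)
  ultimately have "cg_module_axioms G (simplicial_chains K d)"
    by unfold_locales (simp_all add: G del: simplicial_chains_simps(4), simp_all add: inv_id)
  moreover have "module_axioms (ring_of_type_algebra :: complex ring) (simplicial_chains K d)"
    by unfold_locales (auto simp: simplicial_chains_def alternating_def algebra_simps)
  ultimately show ?thesis
    by (intro cg_module.intro module.intro G(1) cring_from_type_algebra
        abelian_group_simplicial_chains)
qed

theorem cg_module_reduced_homology:
  fixes G :: "('a \<Rightarrow> 'a, 'r) monoid_scheme"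
  assumes G: "group G" "monoid.mult G = (\<circ>)" "\<one>\<^bsub>G\<^esub> = id" "\<And>g. g \<in> carrier G \<Longrightarrow> bij g"
    and K: "\<And>g A. g \<in> carrier G \<Longrightarrow> g ` A \<in> K \<longleftrightarrow> A \<in> K"
    and fin: "finite (\<Union>K)" and down: "\<And>A B. A \<in> K \<Longrightarrow> B \<subseteq> A \<Longrightarrow> B \<in> K"
  shows "cg_module G (reduced_homology K d)"
proof -
  interpret C: cg_module G "simplicial_chains K d"
    using G K by (rule cg_module_simplicial_chains)
  interpret C': cg_module G "simplicial_chains K (d + 1)"
    using G K by (rule cg_module_simplicial_chains)
  have gU: "g ` \<Union>K = \<Union>K" if g: "g \<in> carrier G" for g
  proof -
    have "A \<in> (`) g ` K" if "A \<in> K" for A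
    proof
      show "A = g ` (Hilbert_Choice.inv g ` A)"
        using G(4)[OF g] by (simp add: bij_is_surj image_f_inv_f)
      then show "Hilbert_Choice.inv g ` A \<in> K"
        using K[OF g, of "Hilbert_Choice.inv g ` A"] that by simp
    qed
    then have "(`) g ` K = K"
      using K[OF g] by auto
    then show ?thesis
      by (simp add: image_Union)
  qed
  have lin: "boundary K (\<lambda>xs. b xs + c xs) = (\<lambda>xs. boundary K b xs + boundary K c xs)"
    "boundary K (\<lambda>xs. a * c xs) = (\<lambda>xs. a * boundary K c xs)" for a b c
    by (auto simp: boundary_def sum.distrib sum_distrib_left)
  have neg: "\<ominus>\<^bsub>simplicial_chains K e\<^esub> c = (\<lambda>xs. (-1) * c xs)"
    if "c \<in> carrier (simplicial_chains K e)" for e c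
  proof -
    interpret E: cg_module G "simplicial_chains K e"
      using G K by (rule cg_module_simplicial_chains)
    have "(\<lambda>xs. (-1) * c xs) \<in> carrier (simplicial_chains K e)"
      using E.smult_closed[of "-1" c] that by simp
    then show ?thesis
      by (intro E.M.minus_equality) (use that in auto)
  qed
  have Z: "additive_subgroup (cycles K d) (simplicial_chains K d)"
  proof (intro additive_subgroupI subgroup.intro)
    show "cycles K d \<subseteq> carrier (add_monoid (simplicial_chains K d))"
      by (auto simp: cycles_def)
    fix b c assume b: "b \<in> cycles K d" and c: "c \<in> cycles K d"
    show "b \<otimes>\<^bsub>add_monoid (simplicial_chains K d)\<^esub> c \<in> cycles K d"
      using b c C.M.a_closed[of b c] by (auto simp: cycles_def lin)
    have "(\<lambda>xs. (-1) * b xs) \<in> cycles K d"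
      using b C.smult_closed[of "-1" b] lin(2)[of "-1" b] by (auto simp: cycles_def)
    then show "inv\<^bsub>add_monoid (simplicial_chains K d)\<^esub> b \<in> cycles K d"
      using neg[of b d] b by (simp add: a_inv_def cycles_def)
  qed (use C.M.zero_closed in \<open>auto simp: cycles_def boundary_def\<close>)
  have Z_smult: "a \<odot>\<^bsub>simplicial_chains K d\<^esub> c \<in> cycles K d" if "c \<in> cycles K d" for a c
    using that C.smult_closed[of a c] by (auto simp: cycles_def lin)
  have Z_gact: "gact (simplicial_chains K d) g c \<in> cycles K d"
    if "g \<in> carrier G" "c \<in> cycles K d" for g c
    using that C.gact_closed[of g c] boundary_gact[OF G(4) gU, of g d c d]
    by (auto simp: cycles_def)
  let ?Z = "(simplicial_chains K d)\<lparr>carrier := cycles K d\<rparr>"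
  interpret Z: cg_module G ?Z
    using Z Z_smult Z_gact by (rule C.cg_module_restrict)
  have neg_Z: "\<ominus>\<^bsub>?Z\<^esub> c = (\<lambda>xs. (-1) * c xs)" if "c \<in> cycles K d" for c
    using Z_smult[OF that, of "-1"] that by (intro Z.M.minus_equality) auto
  have B: "additive_subgroup (boundaries K d) ?Z"
  proof (intro additive_subgroupI subgroup.intro)
    show BZ: "boundaries K d \<subseteq> carrier (add_monoid ?Z)"
      using boundary_in_cycles[OF fin down] by (auto simp: boundaries_def)
    fix b c assume b: "b \<in> boundaries K d" and c: "c \<in> boundaries K d"
    obtain b' c' where b': "b' \<in> carrier (simplicial_chains K (d + 1))" "b = boundary K b'"
      and c': "c' \<in> carrier (simplicial_chains K (d + 1))" "c = boundary K c'"
      using b c by (auto simp: boundaries_def)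
    show "b \<otimes>\<^bsub>add_monoid ?Z\<^esub> c \<in> boundaries K d"
      using C'.M.a_closed[OF b'(1) c'(1)] lin(1)[of b' c'] b'(2) c'(2)
      by (auto simp: boundaries_def image_iff intro!: bexI)
    have "(\<lambda>xs. (-1) * b xs) \<in> boundaries K d"
      using C'.smult_closed[of "-1" b'] lin(2)[of "-1" b'] b'
      by (auto simp: boundaries_def image_iff intro!: bexI)
    moreover have "b \<in> cycles K d"
      using b BZ by auto
    ultimately show "inv\<^bsub>add_monoid ?Z\<^esub> b \<in> boundaries K d"
      using neg_Z by (simp add: a_inv_def)
  next
    have "boundary K (\<lambda>xs. 0) = (\<lambda>xs. 0)"
      by (auto simp: boundary_def)
    then show "\<one>\<^bsub>add_monoid ?Z\<^esub> \<in> boundaries K d"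
      using C'.M.zero_closed by (auto simp: boundaries_def image_iff intro!: bexI)
  qed
  moreover have "a \<odot>\<^bsub>?Z\<^esub> c \<in> boundaries K d" if c: "c \<in> boundaries K d" for a c
  proof -
    obtain c' where c': "c' \<in> carrier (simplicial_chains K (d + 1))" "c = boundary K c'"
      using c by (auto simp: boundaries_def)
    then show ?thesis
      using C'.smult_closed[of a c'] lin(2)[of a c']
      by (auto simp: boundaries_def intro: rev_image_eqI)
  qed
  moreover have "gact ?Z g c \<in> boundaries K d" if g: "g \<in> carrier G" and c: "c \<in> boundaries K d" for g c
  proof -
    obtain c' where c': "c' \<in> carrier (simplicial_chains K (d + 1))" "c = boundary K c'"
      using c by (auto simp: boundaries_def)
    have "gact ?Z g c = boundary K (gact (simplicial_chains K (d + 1)) g c')"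
      using boundary_gact[OF G(4)[OF g] gU[OF g], of "d + 1" c' d] c' by simp
    then show ?thesis
      using C'.gact_closed[OF g c'(1)] by (auto simp: boundaries_def)
  qed
  ultimately show ?thesis
    unfolding reduced_homology_def by (rule Z.cg_module_quotient)
qed

context matroid
begin

lemma group_aut_group: "group (aut_group M)"
proof (rule groupI)
  fix p assume "p \<in> carrier (aut_group M)"
  then have p: "p permutes ground M" "\<And>A. A \<subseteq> ground M \<Longrightarrow> p ` A \<in> indep M \<longleftrightarrow> A \<in> indep M"
    by (auto simp: aut_group_def)
  let ?q = "Hilbert_Choice.inv p"
  have q: "?q permutes ground M"
    using p(1) by (rule permutes_inv)
  have "?q ` A \<in> indep M \<longleftrightarrow> A \<in> indep M" if "A \<subseteq> ground M" for A
  proof -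
    have "?q ` A \<subseteq> ground M"
      using that q permutes_image by blast
    then have "p ` ?q ` A \<in> indep M \<longleftrightarrow> ?q ` A \<in> indep M"
      by (rule p(2))
    moreover have "p ` ?q ` A = A"
      using p(1) by (simp add: image_image permutes_inverses)
    ultimately show ?thesis by simp
  qed
  then show "\<exists>q\<in>carrier (aut_group M). q \<otimes>\<^bsub>aut_group M\<^esub> p = \<one>\<^bsub>aut_group M\<^esub>"
    using q permutes_inv_o(2)[OF p(1)] by (auto simp: aut_group_def intro!: bexI[of _ ?q])
next
  fix p q assume "p \<in> carrier (aut_group M)" "q \<in> carrier (aut_group M)"
  then have p: "p permutes ground M" "\<And>A. A \<subseteq> ground M \<Longrightarrow> p ` A \<in> indep M \<longleftrightarrow> A \<in> indep M"
    and q: "q permutes ground M" "\<And>A. A \<subseteq> ground M \<Longrightarrow> q ` A \<in> indep M \<longleftrightarrow> A \<in> indep M"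
    by (auto simp: aut_group_def)
  have "p ` q ` A \<in> indep M \<longleftrightarrow> A \<in> indep M" if "A \<subseteq> ground M" for A
  proof -
    have "q ` A \<subseteq> ground M"
      using image_mono[OF that, of q] permutes_image[OF q(1)] by simp
    then show ?thesis
      using p(2)[of "q ` A"] q(2)[OF that] by simp
  qed
  then show "p \<otimes>\<^bsub>aut_group M\<^esub> q \<in> carrier (aut_group M)"
    using permutes_compose[OF q(1) p(1)] by (simp add: aut_group_def image_comp)
qed (auto simp: aut_group_def permutes_id o_assoc)

lemma
  assumes g: "g \<in> carrier (aut_group M)"
  shows aut_indep: "g ` A \<in> indep M \<longleftrightarrow> A \<in> indep M"
    and aut_dual: "g ` A \<in> IN (dual M) \<longleftrightarrow> A \<in> IN (dual M)"
    and aut_NS: "g ` A \<in> NS M \<longleftrightarrow> A \<in> NS M"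
proof -
  have perm: "h permutes ground M" if "h \<in> carrier (aut_group M)" for h
    using that by (simp add: aut_group_def)
  have sub: "h ` A \<subseteq> ground M \<longleftrightarrow> A \<subseteq> ground M" if "h \<in> carrier (aut_group M)" for h A
    using permutes_in_image[OF perm[OF that]] by auto
  have ind: "h ` A \<in> indep M \<longleftrightarrow> A \<in> indep M" if "h \<in> carrier (aut_group M)" for h A
    using that sub[OF that, of A] indep_subset[of A] indep_subset[of "h ` A"]
    by (auto simp: aut_group_def)
  show "g ` A \<in> indep M \<longleftrightarrow> A \<in> indep M"
    using g by (rule ind)
  define h where "h = Hilbert_Choice.inv g"
  have inv: "inv\<^bsub>aut_group M\<^esub> g = h"
  proof (rule group.inv_equality[OF group_aut_group])
    obtain k where "k \<in> carrier (aut_group M)" "k \<otimes>\<^bsub>aut_group M\<^esub> g = \<one>\<^bsub>aut_group M\<^esub>"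
      using group.l_inv_ex[OF group_aut_group g] by blast
    then have "k \<circ> g = id"
      by (simp add: aut_group_def)
    then have "k = h"
      unfolding h_def using permutes_bij[OF perm[OF g]] by (metis bij_is_surj comp_assoc comp_id
          id_comp surj_iff)
    then show "h \<in> carrier (aut_group M)" "h \<otimes>\<^bsub>aut_group M\<^esub> g = \<one>\<^bsub>aut_group M\<^esub>"
      using \<open>k \<in> _\<close> \<open>k \<otimes>\<^bsub>aut_group M\<^esub> g = _\<close> by simp_all
  qed (rule g)
  have h: "h \<in> carrier (aut_group M)"
    using group.inv_closed[OF group_aut_group g] by (simp add: inv)
  have hg: "h ` g ` A = A" for A
    unfolding h_def using permutes_inj[OF perm[OF g]] by (simp add: image_inv_f_f)
  have gh: "g ` h ` A = A" for A
    unfolding h_def using permutes_surj[OF perm[OF g]] by (simp add: image_f_inv_f)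
  have bas: "k ` B \<in> bases M" if k: "k \<in> carrier (aut_group M)" and l: "l \<in> carrier (aut_group M)"
    and kl: "\<And>A. k ` l ` A = A" "\<And>A. l ` k ` A = A" and B: "B \<in> bases M" for k l B
    unfolding bases_def
  proof (intro CollectI conjI ballI impI)
    show "k ` B \<in> indep M"
      using B ind[OF k] by (simp add: bases_def)
    fix I assume I: "I \<in> indep M" "k ` B \<subseteq> I"
    then have "B \<subseteq> l ` I" "l ` I \<in> indep M"
      using ind[OF l] kl(2)[of B] image_mono[OF I(2), of l] by simp_all
    then have "l ` I = B"
      using B by (simp add: bases_def)
    then show "I = k ` B"
      using kl(1)[of I] by simp
  qed
  have dl: "k ` A \<in> IN (dual M)" if k: "k \<in> carrier (aut_group M)" and l: "l \<in> carrier (aut_group M)"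
    and kl: "\<And>A. k ` l ` A = A" "\<And>A. l ` k ` A = A" and A: "A \<in> IN (dual M)" for k l A
  proof -
    obtain B where B: "B \<in> bases M" "A \<subseteq> ground M - B"
      using A by (auto simp: IN_def dual_def)
    have "k ` A \<subseteq> k ` ground M - k ` B"
      using B(2) image_mono[OF B(2), of k] image_set_diff[OF permutes_inj[OF perm[OF k]]] by metis
    then show ?thesis
      using bas[OF k l kl B(1)] permutes_image[OF perm[OF k]] by (auto simp: IN_def dual_def)
  qed
  show "g ` A \<in> IN (dual M) \<longleftrightarrow> A \<in> IN (dual M)"
    using dl[OF g h gh hg, of A] dl[OF h g hg gh, of "g ` A"] hg[of A] by auto
  have "card ` {I \<in> indep M. I \<subseteq> g ` A} = card ` {I \<in> indep M. I \<subseteq> A}"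
  proof -
    have "{I \<in> indep M. I \<subseteq> g ` A} = (`) g ` {I \<in> indep M. I \<subseteq> A}"
    proof (intro Set.set_eqI iffI)
      fix I assume "I \<in> {I \<in> indep M. I \<subseteq> g ` A}"
      then have "h ` I \<in> {I \<in> indep M. I \<subseteq> A}"
        using ind[OF h] hg[of A] image_mono[of I "g ` A" h] by auto
      then show "I \<in> (`) g ` {I \<in> indep M. I \<subseteq> A}"
        using gh[of I] by (metis imageI)
    qed (use ind[OF g] in auto)
    moreover have "card (g ` I) = card I" for I
      using permutes_inj[OF perm[OF g]] by (metis card_image inj_on_subset subset_UNIV)
    ultimately show ?thesis
      by (simp add: image_image)
  qed
  then show "g ` A \<in> NS M \<longleftrightarrow> A \<in> NS M"
    using sub[OF g] by (simp add: NS_def rk_def)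
qed

lemma rk_mono:
  assumes "A \<subseteq> B"
  shows "rk M A \<le> rk M B"
  unfolding rk_def
proof (rule Max_mono)
  have "indep M \<subseteq> Pow (ground M)"
    using indep_subset by blast
  then have "finite (indep M)"
    using finite_ground finite_subset by auto
  then show "finite (card ` {I \<in> indep M. I \<subseteq> B})"
    by simp
qed (use assms empty_indep in auto)

theorem
  shows cg_module_NS: "cg_module (aut_group M) (reduced_homology (NS M) d)"
    and cg_module_IN_dual: "cg_module (aut_group M) (reduced_homology (IN (dual M)) d)"
    and cg_module_IN_dual_sgn:
      "cg_module (aut_group M) (tensor_character (reduced_homology (IN (dual M)) d) sgn_character)"
proof -
  have aut: "monoid.mult (aut_group M) = (\<circ>)" "\<one>\<^bsub>aut_group M\<^esub> = id"
    "\<And>g. g \<in> carrier (aut_group M) \<Longrightarrow> bij g"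
    by (auto simp: aut_group_def permutes_bij)
  show "cg_module (aut_group M) (reduced_homology (NS M) d)"
  proof (rule cg_module_reduced_homology[OF group_aut_group aut aut_NS])
    show "finite (\<Union>(NS M))"
      by (rule finite_subset[OF _ finite_ground]) (auto simp: NS_def)
    show "\<And>A B. A \<in> NS M \<Longrightarrow> B \<subseteq> A \<Longrightarrow> B \<in> NS M"
      by (auto simp: NS_def intro: le_less_trans[OF rk_mono])
  qed
  show D: "cg_module (aut_group M) (reduced_homology (IN (dual M)) d)"
  proof (rule cg_module_reduced_homology[OF group_aut_group aut aut_dual])
    show "finite (\<Union>(IN (dual M)))"
      by (rule finite_subset[OF _ finite_ground]) (auto simp: IN_def dual_def)
    show "\<And>A B. A \<in> IN (dual M) \<Longrightarrow> B \<subseteq> A \<Longrightarrow> B \<in> IN (dual M)"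
      by (auto simp: IN_def dual_def)
  qed
  have "sign (g \<circ> h) = sign g * sign h"
    if "g \<in> carrier (aut_group M)" "h \<in> carrier (aut_group M)" for g h
    using that finite_ground
    by (intro sign_compose permutation_permutes[THEN iffD2]) (auto simp: aut_group_def)
  then show "cg_module (aut_group M)
      (tensor_character (reduced_homology (IN (dual M)) d) sgn_character)"
    by (intro cg_module.cg_module_tensor_character[OF D]) (simp_all add: aut sgn_character_def)
qed

end

end

theory Submission
  imports Defs "HOL-Combinatorics.Multiset_Permutations"
begin

text \<open>A set spans \<open>M\<close> iff it contains a basis, that is, iff its complement is independent in the dual
  matroid. So \<open>NS(M)\<close> is the Alexander dual of \<open>K = IN(M*)\<close> (\<open>NS_eq_alexander_dual\<close>): its faces are the
  complements of the non-faces of \<open>K\<close>. The isomorphism is combinatorial Alexander duality, carried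
  out compatibly with the permutations that preserve \<open>K\<close> (\<open>alexander_duality\<close>).

  All chains are compared inside the full simplex on the ground set \<open>E\<close>, with boundary \<open>\<partial>\<close> and
  coboundary \<open>\<delta>\<close>. Three facts about it carry the proof. First, \<open>\<partial>\<delta> + \<delta>\<partial>\<close> is multiplication by \<open>|E|\<close>
  (\<open>simplex_homotopy\<close>), so that the full simplex is acyclic, by a homotopy that commutes with all
  permutations of \<open>E\<close>. Second, \<open>\<partial>\<close> and \<open>\<delta>\<close> are adjoint for the inner product in which oriented
  simplices are orthonormal (\<open>pairing_boundary\<close>), so that homology and cohomology classes of \<open>K\<close>
  have the same harmonic representatives; cohomology thus appears as the same representation as
  homology, not as its dual. Third, the Hodge star takes a simplex to its
  complement and exchanges \<open>\<delta>\<close> with \<open>\<partial>\<close> up to sign (\<open>star_codiff\<close>). It depends on an orientation of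
  the full simplex, on which a permutation acts by its sign (\<open>star_map\<close>); this is the only source of
  the twist by \<open>sgn\<close>.

  The resulting isomorphism takes the class of a harmonic \<open>d\<close>-chain \<open>h\<close> of \<open>K\<close> to the class of
  \<open>star (\<delta> h)\<close>. Here \<open>\<delta> h\<close> has \<open>d + 2\<close> vertices in each of its simplices and vanishes on the faces of
  \<open>K\<close>, so its star is a chain of \<open>NS(M)\<close> in dimension \<open>n - 3 - d\<close>.\<close>

section \<open>Alternating functions on lists\<close>

text \<open>Alternation in terms of adjacent swaps, a form that visibly persists when the head of the list is
  fixed, as list recursion requires.\<close>
definition antisymmetric :: "('a list \<Rightarrow> complex) \<Rightarrow> bool" where
  "antisymmetric c \<longleftrightarrow> (\<forall>as x y bs. c (as @ x # y # bs) = - c (as @ y # x # bs))"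

lemma antisymmetricD: "antisymmetric c \<Longrightarrow> c (as @ x # y # bs) = - c (as @ y # x # bs)"
  unfolding antisymmetric_def by blast

lemma antisymmetric_move:
  assumes "antisymmetric c"
  shows "c (as @ x # bs @ cs) = (- 1) ^ length bs * c (as @ bs @ x # cs)"
proof (induction bs arbitrary: as)
  case (Cons b bs)
  have "c (as @ x # (b # bs) @ cs) = - c ((as @ [b]) @ x # bs @ cs)"
    using antisymmetricD[OF assms, of as x b "bs @ cs"] by simp
  then show ?case
    by (simp only: Cons.IH) simp
qed simp

lemma antisymmetric_move_block:
  assumes "antisymmetric c"
  shows "c (xs @ ys @ zs) = (- 1) ^ (length xs * length ys) * c (ys @ xs @ zs)"
proof (induction xs arbitrary: zs)
  case (Cons x xs)
  have "c ((x # xs) @ ys @ zs) = (- 1) ^ (length xs + length ys) * c (xs @ ys @ x # zs)"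
    using antisymmetric_move[OF assms, of "[]" x "xs @ ys" zs] by simp
  also have "\<dots> = (- 1) ^ (length xs + length ys) * (- 1) ^ (length xs * length ys) * c (ys @ xs @ x # zs)"
    using Cons.IH[of "x # zs"] by simp
  also have "c (ys @ xs @ x # zs) = (- 1) ^ length xs * c (ys @ (x # xs) @ zs)"
    using antisymmetric_move[OF assms, of ys x xs zs] by simp
  finally show ?case
    by (simp add: power_add mult.commute mult.left_commute)
qed simp

lemma antisymmetric_swap:
  assumes "antisymmetric c"
  shows "c (as @ x # bs @ y # cs) = - c (as @ y # bs @ x # cs)"
proof -
  have "c (as @ x # bs @ y # cs) = (- 1) ^ length bs * c ((as @ bs) @ x # y # cs)"
    using antisymmetric_move[OF assms, of as x bs "y # cs"] by simp
  also have "\<dots> = - ((- 1) ^ length bs * c (as @ bs @ y # x # cs))"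
    using antisymmetricD[OF assms, of "as @ bs" x y cs] by simp
  also have "\<dots> = - c (as @ y # bs @ x # cs)"
    using antisymmetric_move[OF assms, of as y bs "x # cs"] by simp
  finally show ?thesis .
qed

text \<open>Stated for a list already cut at the two positions, so that index arithmetic stays inside the
  proof.\<close>
lemma permute_list_transpose:
  "permute_list (transpose (length as) (Suc (length as + length bs))) (as @ x # bs @ y # cs) =
     as @ y # bs @ x # cs"
proof -
  have "permute_list (transpose i j) xs = xs[i := xs ! j, j := xs ! i]"
    if "i < length xs" "j < length xs" for i j and xs :: "'a list"
  proof (rule nth_equalityI)
    have t: "transpose i j permutes {..<length xs}"
      using that by (intro permutes_swap_id) auto
    fix k assume "k < length (permute_list (transpose i j) xs)"
    then show "permute_list (transpose i j) xs ! k = xs[i := xs ! j, j := xs ! i] ! k"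
      using that permute_list_nth[OF t, of k] by (simp add: nth_list_update transpose_def)
  qed simp
  then show ?thesis
    by (simp add: list_update_append nth_append)
qed

text \<open>Adjacent swaps generate the symmetric group: an arbitrary transposition moves one entry past the
  block between the two positions and the other one back, which costs an odd number of swaps.\<close>
lemma alternating_iff_antisymmetric: "alternating c \<longleftrightarrow> antisymmetric c"
proof
  assume alt: "alternating c"
  show "antisymmetric c"
    unfolding antisymmetric_def
  proof (intro allI)
    fix as bs :: "'a list" and x y :: 'a
    let ?xs = "as @ y # x # bs" and ?t = "transpose (length as) (Suc (length as))"
    have t: "?t permutes {..<length ?xs}"
      by (intro permutes_swap_id) auto
    have "permute_list ?t ?xs = as @ x # y # bs"
      using permute_list_transpose[of as "[]" y x bs] by simp
    then show "c (as @ x # y # bs) = - c (as @ y # x # bs)"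
      using alt[unfolded alternating_def, rule_format, OF t] by (simp add: sign_swap_id)
  qed
next
  assume anti: "antisymmetric c"
  have transp: "c (permute_list (transpose i j) xs) = - c xs" if ij: "i < j" "j < length xs" for i j xs
  proof -
    obtain as bs cs where xs: "xs = as @ xs ! i # bs @ xs ! j # cs" "length as = i"
      "Suc (length as + length bs) = j"
    proof
      have "drop (Suc i) xs = take (j - Suc i) (drop (Suc i) xs) @ xs ! j # drop (Suc j) xs"
        using ij by (subst append_take_drop_id[of "j - Suc i", symmetric]) (simp add: Cons_nth_drop_Suc)
      then show "xs = take i xs @ xs ! i # take (j - Suc i) (drop (Suc i) xs) @ xs ! j # drop (Suc j) xs"
        using ij id_take_nth_drop[of i xs] by simp
    qed (use ij in auto)
    then show ?thesis
      using permute_list_transpose[of as bs "xs ! i" "xs ! j" cs]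
        antisymmetric_swap[OF anti, of as "xs ! i" bs "xs ! j" cs] by simp
  qed
  have "\<forall>xs. length xs = n \<longrightarrow> c (permute_list p xs) = of_int (sign p) * c xs"
    if "p permutes {..<n}" for p n
    using that finite_lessThan
  proof (induction rule: permutes_induct)
    case (swap a b p)
    let ?t = "transpose a b"
    have t: "?t permutes {..<n}"
      using swap by (intro permutes_swap_id) auto
    have sg: "sign (?t \<circ> p) = - sign p"
      using sign_permute_compose[OF t swap(4)] swap(3) by (simp add: sign_swap_id)
    show ?case
    proof (intro allI impI)
      fix xs :: "'a list" assume len: "length xs = n"
      have "c (permute_list ?t xs) = - c xs"
        using swap(1-3) len transp[of a b xs] transp[of b a xs]
        by (cases "a < b") (auto simp: transpose_commute[of a b])
      moreover have "permute_list (?t \<circ> p) xs = permute_list p (permute_list ?t xs)"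
        using swap(4) len by (intro permute_list_compose) simp
      ultimately show "c (permute_list (?t \<circ> p) xs) = of_int (sign (?t \<circ> p)) * c xs"
        using swap(5) len sg by simp
    qed
  qed simp_all
  then show "alternating c"
    by (simp add: alternating_def)
qed

lemma antisymmetric_eq_0:
  assumes "antisymmetric c" "\<not> distinct xs"
  shows "c xs = 0"
proof -
  obtain as x bs cs where "xs = as @ [x] @ bs @ [x] @ cs"
    using not_distinct_decomp[OF assms(2)] by blast
  then show ?thesis
    using antisymmetric_swap[OF assms(1), of as x bs x cs] by simp
qed

lemma antisymmetric_Cons: "antisymmetric c \<Longrightarrow> antisymmetric (\<lambda>xs. c (x # xs))"
  unfolding antisymmetric_def by (metis append_Cons)

text \<open>Alternation already forces the entries of a list in the support to be distinct.\<close>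
lemma simplicial_chains_iff:
  "c \<in> carrier (simplicial_chains K d) \<longleftrightarrow>
     antisymmetric c \<and> (\<forall>xs. c xs \<noteq> 0 \<longrightarrow> set xs \<in> K \<and> int (length xs) = d + 1)"
proof -
  have "(\<forall>xs. xs \<notin> ordered_faces K d \<longrightarrow> c xs = 0) \<longleftrightarrow>
      (\<forall>xs. c xs \<noteq> 0 \<longrightarrow> set xs \<in> K \<and> int (length xs) = d + 1)" if "antisymmetric c"
    using antisymmetric_eq_0[OF that] unfolding ordered_faces_def by blast
  then show ?thesis
    by (auto simp only: simplicial_chains_def alternating_iff_antisymmetric partial_object.simps mem_Collect_eq)
qed

section \<open>The alternating coboundary\<close>

text \<open>The alternating sum \<open>\<Sum>i. (- 1) ^ i * c (xs without its i-th entry)\<close>. In recursive form the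
  identities below become inductions on the list, and the homotopy formula \<open>sum_codiff\<close> becomes a
  restatement of the second equation.\<close>
fun codiff :: "('a list \<Rightarrow> complex) \<Rightarrow> 'a list \<Rightarrow> complex" where
  "codiff c [] = 0"
| "codiff c (x # xs) = c xs - codiff (\<lambda>ys. c (x # ys)) xs"

lemma codiff_lin:
  "codiff (\<lambda>xs. b xs + c xs) xs = codiff b xs + codiff c xs"
  "codiff (\<lambda>xs. b xs - c xs) xs = codiff b xs - codiff c xs"
  "codiff (\<lambda>xs. a * c xs) xs = a * codiff c xs"
  "codiff (\<lambda>xs. 0) xs = 0"
  "codiff (\<lambda>xs. cnj (c xs)) xs = cnj (codiff c xs)"
proof -
  show "codiff (\<lambda>xs. b xs + c xs) xs = codiff b xs + codiff c xs"
    by (induction xs arbitrary: b c) simp_all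
  show "codiff (\<lambda>xs. b xs - c xs) xs = codiff b xs - codiff c xs"
    by (induction xs arbitrary: b c) simp_all
  show "codiff (\<lambda>xs. a * c xs) xs = a * codiff c xs"
    by (induction xs arbitrary: c) (simp_all add: right_diff_distrib)
  show "codiff (\<lambda>xs. 0) xs = 0"
    by (induction xs) simp_all
  show "codiff (\<lambda>xs. cnj (c xs)) xs = cnj (codiff c xs)"
    by (induction xs arbitrary: c) simp_all
qed

lemma codiff_sum: "codiff (\<lambda>xs. \<Sum>v\<in>V. c v xs) xs = (\<Sum>v\<in>V. codiff (c v) xs)"
  by (induction xs arbitrary: c) (simp_all add: sum_subtractf)

text \<open>Only sublists are evaluated, so the values of \<open>codiff c\<close> on the faces of a complex are determined
  by those of \<open>c\<close>.\<close>
lemma codiff_cong: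
  assumes "\<And>ys. set ys \<subseteq> set xs \<Longrightarrow> length xs = Suc (length ys) \<Longrightarrow> b ys = c ys"
  shows "codiff b xs = codiff c xs"
  using assms
proof (induction xs arbitrary: b c)
  case (Cons x xs)
  have "codiff (\<lambda>ys. b (x # ys)) xs = codiff (\<lambda>ys. c (x # ys)) xs"
    by (rule Cons.IH) (rule Cons.prems, auto)
  then show ?case
    using Cons.prems[of xs] by auto
qed simp

lemma codiff_codiff: "codiff (codiff c) xs = 0"
  by (induction xs arbitrary: c) (simp_all add: codiff_lin)

lemma codiff_map: "codiff (\<lambda>xs. c (map f xs)) xs = codiff c (map f xs)"
proof (induction xs arbitrary: c)
  case (Cons x xs)
  show ?case
    using Cons.IH[of "\<lambda>ys. c (f x # ys)"] by simp
qed simp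

lemma antisymmetric_codiff:
  assumes "antisymmetric c"
  shows "antisymmetric (codiff c)"
proof -
  have "codiff c (as @ x # y # bs) = - codiff c (as @ y # x # bs)" for as x y bs
    using assms
  proof (induction as arbitrary: c)
    case Nil
    have "codiff (\<lambda>ys. c (x # y # ys)) bs = codiff (\<lambda>ys. (- 1) * c (y # x # ys)) bs"
    proof (rule codiff_cong)
      fix ys
      show "c (x # y # ys) = (- 1) * c (y # x # ys)"
        using antisymmetricD[OF Nil, of "[]" x y ys] by (simp only: append_Nil mult_minus1)
    qed
    also have "\<dots> = - codiff (\<lambda>ys. c (y # x # ys)) bs"
      by (subst codiff_lin(3)) simp
    finally have eq: "codiff (\<lambda>ys. c (x # y # ys)) bs = - codiff (\<lambda>ys. c (y # x # ys)) bs" .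
    show ?case
      by (simp only: append_Nil codiff.simps eq) simp
  next
    case (Cons a as)
    have "codiff (\<lambda>ys. c (a # ys)) (as @ x # y # bs) = - codiff (\<lambda>ys. c (a # ys)) (as @ y # x # bs)"
      by (rule Cons.IH) (rule antisymmetric_Cons[OF Cons.prems])
    then show ?case
      using antisymmetricD[OF Cons.prems, of as x y bs]
      by (simp only: append_Cons codiff.simps minus_diff_minus)
  qed
  then show ?thesis
    unfolding antisymmetric_def by blast
qed

text \<open>With \<open>V\<close> the vertex set of a simplex, this says that the boundary \<open>\<partial>\<close> and the coboundary \<open>\<delta>\<close> satisfy
  \<open>\<partial>\<delta> + \<delta>\<partial> = |V|\<close>: contracting against all vertices at once is a homotopy that treats them
  symmetrically, hence commutes with permutations of \<open>V\<close>.\<close>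
lemma sum_codiff:
  "(\<Sum>v\<in>V. codiff c (v # xs)) + codiff (\<lambda>xs. \<Sum>v\<in>V. c (v # xs)) xs = of_nat (card V) * c xs"
  by (simp add: codiff_sum sum_subtractf)

text \<open>Cutting off outside \<open>K\<close> matters even for the full simplex \<open>Pow E\<close>, because \<open>codiff c\<close> need not
  vanish on lists with an entry outside \<open>E\<close>.\<close>
definition coboundary :: "'a set set \<Rightarrow> ('a list \<Rightarrow> complex) \<Rightarrow> 'a list \<Rightarrow> complex" where
  "coboundary K c xs = (if set xs \<in> K then codiff c xs else 0)"

definition chain_restrict :: "'a set set \<Rightarrow> ('a list \<Rightarrow> complex) \<Rightarrow> 'a list \<Rightarrow> complex" where
  "chain_restrict K c xs = (if set xs \<in> K then c xs else 0)"

lemma antisymmetric_chain_restrict: "antisymmetric c \<Longrightarrow> antisymmetric (chain_restrict K c)"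
  unfolding antisymmetric_def
proof (intro allI)
  fix as x y bs
  assume "\<forall>as x y bs. c (as @ x # y # bs) = - c (as @ y # x # bs)"
  then have "c (as @ x # y # bs) = - c (as @ y # x # bs)" by blast
  moreover have "set (as @ x # y # bs) = set (as @ y # x # bs)" by auto
  ultimately show "chain_restrict K c (as @ x # y # bs) = - chain_restrict K c (as @ y # x # bs)"
    by (simp add: chain_restrict_def)
qed

lemma coboundary_eq: "coboundary K c = chain_restrict K (codiff c)"
  by (auto simp: coboundary_def chain_restrict_def)

lemma chain_restrict_in_chains:
  assumes "c \<in> carrier (simplicial_chains L d)"
  shows "chain_restrict K c \<in> carrier (simplicial_chains (K \<inter> L) d)"
  using assms antisymmetric_chain_restrict[of c K] unfolding simplicial_chains_iff
  by (auto simp: chain_restrict_def)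

lemma coboundary_in_chains:
  assumes "c \<in> carrier (simplicial_chains L d)"
  shows "coboundary K c \<in> carrier (simplicial_chains K (d + 1))"
  unfolding simplicial_chains_iff
proof (intro conjI allI impI)
  show "antisymmetric (coboundary K c)"
    using assms by (simp add: coboundary_eq simplicial_chains_iff antisymmetric_codiff antisymmetric_chain_restrict)
  fix xs assume nz: "coboundary K c xs \<noteq> 0"
  then show "set xs \<in> K"
    by (auto simp: coboundary_def split: if_splits)
  show "int (length xs) = d + 1 + 1"
  proof (rule ccontr)
    assume "int (length xs) \<noteq> d + 1 + 1"
    then have "codiff c xs = codiff (\<lambda>_. 0) xs"
      using assms by (intro codiff_cong) (auto simp: simplicial_chains_iff)
    then show False
      using nz by (simp add: codiff_lin coboundary_def split: if_splits)
  qed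
qed

lemma coboundary_lin:
  "coboundary K (\<lambda>xs. b xs + c xs) = (\<lambda>xs. coboundary K b xs + coboundary K c xs)"
  "coboundary K (\<lambda>xs. b xs - c xs) = (\<lambda>xs. coboundary K b xs - coboundary K c xs)"
  "coboundary K (\<lambda>xs. a * c xs) = (\<lambda>xs. a * coboundary K c xs)"
  "coboundary K (\<lambda>xs. 0) = (\<lambda>xs. 0)"
  by (auto simp: coboundary_def codiff_lin)

text \<open>Restriction of cochains to a subcomplex commutes with the coboundary, since faces of faces are
  faces.\<close>
lemma coboundary_restrict:
  assumes "\<And>A B. A \<in> K \<Longrightarrow> B \<subseteq> A \<Longrightarrow> B \<in> K"
  shows "coboundary K (chain_restrict K c) = coboundary K c"
proof
  fix xs
  show "coboundary K (chain_restrict K c) xs = coboundary K c xs"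
    using assms by (auto simp: coboundary_def chain_restrict_def intro!: codiff_cong)
qed

lemma coboundary_coboundary:
  assumes "\<And>A B. A \<in> K \<Longrightarrow> B \<subseteq> A \<Longrightarrow> B \<in> K"
  shows "coboundary K (coboundary K c) = (\<lambda>xs. 0)"
proof -
  have "coboundary K (coboundary K c) = coboundary K (codiff c)"
    unfolding coboundary_eq[of K c] by (rule coboundary_restrict) (use assms in blast)
  then show ?thesis
    by (simp add: coboundary_def codiff_codiff fun_eq_iff)
qed

section \<open>The pairing of chains\<close>

text \<open>The length bound makes the set finite and loses nothing: alternating functions vanish on lists
  with repeated entries.\<close>
definition lists_upto :: "'a set \<Rightarrow> 'a list set" where
  "lists_upto E = {xs. set xs \<subseteq> E \<and> length xs \<le> card E}"

text \<open>A simplex is counted once for each of its orderings, and the factorial corrects this. So oriented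
  simplices form an orthonormal basis up to sign, and \<open>boundary\<close> and \<open>codiff\<close> are exactly adjoint.\<close>
definition pairing :: "'a set \<Rightarrow> ('a list \<Rightarrow> complex) \<Rightarrow> ('a list \<Rightarrow> complex) \<Rightarrow> complex" where
  "pairing E b c = (\<Sum>xs\<in>lists_upto E. b xs * c xs / fact (length xs))"

lemma finite_lists_upto: "finite E \<Longrightarrow> finite (lists_upto E)"
  unfolding lists_upto_def by (rule finite_lists_length_le)

lemma pairing_lin:
  "pairing E (\<lambda>xs. a xs + b xs) c = pairing E a c + pairing E b c"
  "pairing E (\<lambda>xs. a xs - b xs) c = pairing E a c - pairing E b c"
  "pairing E (\<lambda>xs. t * b xs) c = t * pairing E b c"
  "pairing E b (\<lambda>xs. a xs + c xs) = pairing E b a + pairing E b c"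
  "pairing E b (\<lambda>xs. a xs - c xs) = pairing E b a - pairing E b c"
  "pairing E b (\<lambda>xs. t * c xs) = t * pairing E b c"
  by (simp_all add: pairing_def algebra_simps sum.distrib sum_subtractf add_divide_distrib
      diff_divide_distrib sum_distrib_left)

lemma pairing_cong:
  assumes "\<And>xs. set xs \<subseteq> E \<Longrightarrow> b xs * c xs = b' xs * c' xs"
  shows "pairing E b c = pairing E b' c'"
  unfolding pairing_def by (rule sum.cong) (use assms in \<open>auto simp: lists_upto_def\<close>)

lemma sum_lists_Suc:
  assumes "finite E"
  shows "(\<Sum>ys | set ys \<subseteq> E \<and> length ys = Suc m. f ys) =
    (\<Sum>v\<in>E. \<Sum>xs | set xs \<subseteq> E \<and> length xs = m. f (v # xs))"
proof -
  have "{ys. set ys \<subseteq> E \<and> length ys = Suc m} =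
      (\<lambda>(v, xs). v # xs) ` (E \<times> {xs. set xs \<subseteq> E \<and> length xs = m})"
    by (auto simp: length_Suc_conv image_iff)
  moreover have "inj_on (\<lambda>(v, xs). v # xs) (E \<times> {xs. set xs \<subseteq> E \<and> length xs = m})"
    by (auto simp: inj_on_def)
  ultimately show ?thesis
    by (simp add: sum.reindex sum.cartesian_product o_def case_prod_unfold)
qed

text \<open>By alternation, each of the \<open>m + 1\<close> terms of \<open>codiff\<close> contributes as much as the one that drops the
  first entry. In the induction the sign of the recursion cancels the one from exchanging the first
  two entries.\<close>
lemma sum_codiff_adjoint:
  assumes E: "finite E" and b: "antisymmetric b"
  shows "(\<Sum>ys | set ys \<subseteq> E \<and> length ys = Suc m. b ys * codiff c ys) =
    of_nat (Suc m) * (\<Sum>xs | set xs \<subseteq> E \<and> length xs = m. (\<Sum>v\<in>E. b (v # xs)) * c xs)"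
  using b
proof (induction m arbitrary: b c)
  case 0
  have "{xs. set xs \<subseteq> E \<and> length xs = 0} = {[]}" by auto
  then show ?case
    by (simp add: sum_lists_Suc[OF E] sum_distrib_right)
next
  case (Suc m)
  let ?L = "\<lambda>m. {xs. set xs \<subseteq> E \<and> length xs = m}"
  let ?A = "\<Sum>xs\<in>?L (Suc m). (\<Sum>v\<in>E. b (v # xs)) * c xs"
  have "(\<Sum>v\<in>E. \<Sum>xs\<in>?L (Suc m). b (v # xs) * codiff (\<lambda>ys. c (v # ys)) xs) =
      (\<Sum>v\<in>E. of_nat (Suc m) * (\<Sum>xs\<in>?L m. (\<Sum>w\<in>E. b (v # w # xs)) * c (v # xs)))"
    by (intro sum.cong refl Suc.IH antisymmetric_Cons Suc.prems)
  also have "\<dots> = (\<Sum>v\<in>E. of_nat (Suc m) * (\<Sum>xs\<in>?L m. - (\<Sum>w\<in>E. b (w # v # xs)) * c (v # xs)))"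
  proof -
    have "(\<Sum>w\<in>E. b (v # w # xs)) = - (\<Sum>w\<in>E. b (w # v # xs))" for v xs
      unfolding sum_negf[symmetric] 
      by (intro sum.cong refl antisymmetricD[OF Suc.prems, of "[]" v _ xs, unfolded append_Nil])
    then show ?thesis by simp
  qed
  also have "\<dots> = - of_nat (Suc m) * ?A"
    by (simp add: sum_lists_Suc[OF E] sum_distrib_left sum_negf del: of_nat_Suc)
  finally have 1: "(\<Sum>v\<in>E. \<Sum>xs\<in>?L (Suc m). b (v # xs) * codiff (\<lambda>ys. c (v # ys)) xs) =
      - of_nat (Suc m) * ?A" .
  have "(\<Sum>v\<in>E. \<Sum>xs\<in>?L (Suc m). b (v # xs) * c xs) = ?A"
    by (subst sum.swap) (simp add: sum_distrib_right)
  then have "(\<Sum>ys\<in>?L (Suc (Suc m)). b ys * codiff c ys) = ?A - (- of_nat (Suc m) * ?A)"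
    unfolding 1[symmetric] sum_lists_Suc[OF E, of _ "Suc m"]
    by (simp add: right_diff_distrib sum_subtractf)
  also have "\<dots> = of_nat (Suc (Suc m)) * ?A"
    by (simp add: algebra_simps)
  finally show ?case .
qed

lemma pairing_by_length:
  assumes "finite E"
  shows "pairing E b c =
    (\<Sum>m\<le>card E. (\<Sum>xs | set xs \<subseteq> E \<and> length xs = m. b xs * c xs) / fact m)"
proof -
  have "pairing E b c =
      (\<Sum>m\<le>card E. \<Sum>xs | xs \<in> lists_upto E \<and> length xs = m. b xs * c xs / fact (length xs))"
    unfolding pairing_def
    by (rule sum.group[symmetric]) (use finite_lists_upto[OF assms] in \<open>auto simp: lists_upto_def\<close>)
  also have "\<dots> = (\<Sum>m\<le>card E. (\<Sum>xs | set xs \<subseteq> E \<and> length xs = m. b xs * c xs) / fact m)"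
    unfolding sum_divide_distrib by (intro sum.cong) (auto simp: lists_upto_def)
  finally show ?thesis .
qed

lemma boundary_Pow: "boundary (Pow E) c xs = (\<Sum>v\<in>E. c (v # xs))"
  by (simp add: boundary_def)

lemma pairing_boundary:
  assumes E: "finite E" and b: "antisymmetric b"
  shows "pairing E (boundary (Pow E) b) c = pairing E b (codiff c)"
proof -
  let ?L = "\<lambda>m. {xs. set xs \<subseteq> E \<and> length xs = m}"
  let ?T = "\<lambda>m. \<Sum>xs\<in>?L m. (\<Sum>v\<in>E. b (v # xs)) * c xs"
  \<comment> \<open>In top length the boundary vanishes, as no distinct list over \<open>E\<close> has more than \<open>card E\<close> entries;
    and \<open>codiff\<close> vanishes in length \<open>0\<close>. So the two sums agree after an index shift.\<close>
  have "b (v # xs) = 0" if "set xs \<subseteq> E" "length xs = card E" "v \<in> E" for v xs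
  proof (rule antisymmetric_eq_0[OF b], rule notI)
    assume "distinct (v # xs)"
    then have "card (set (v # xs)) = Suc (card E)"
      using that distinct_card[of "v # xs"] by simp
    moreover have "card (set (v # xs)) \<le> card E"
      using that by (intro card_mono E) auto
    ultimately show False by simp
  qed
  then have "?T (card E) = 0"
    by (auto intro!: sum.neutral)
  then have "pairing E (boundary (Pow E) b) c = (\<Sum>m<card E. ?T m / fact m)"
    by (simp add: pairing_by_length[OF E] boundary_Pow flip: lessThan_Suc_atMost)
  also have "\<dots> = (\<Sum>m<card E. (\<Sum>ys\<in>?L (Suc m). b ys * codiff c ys) / fact (Suc m))"
    unfolding sum_codiff_adjoint[OF E b] by (intro sum.cong) (simp_all del: of_nat_Suc)
  also have "\<dots> = pairing E b (codiff c)"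
  proof -
    have "?L 0 = {[]}" by auto
    then have "(\<Sum>ys\<in>?L 0. b ys * codiff c ys) = 0" by simp
    then show ?thesis
      unfolding pairing_by_length[OF E] sum.atMost_shift by simp
  qed
  finally show ?thesis .
qed

definition lin_subspace :: "('b \<Rightarrow> complex) set \<Rightarrow> bool" where
  "lin_subspace U \<longleftrightarrow> (\<lambda>x. 0) \<in> U \<and> (\<forall>u\<in>U. \<forall>v\<in>U. (\<lambda>x. u x + v x) \<in> U) \<and>
     (\<forall>a. \<forall>u\<in>U. (\<lambda>x. a * u x) \<in> U)"

lemma lin_subspaceD:
  assumes "lin_subspace U"
  shows "(\<lambda>x. 0) \<in> U"
    "u \<in> U \<Longrightarrow> v \<in> U \<Longrightarrow> (\<lambda>x. u x + v x) \<in> U"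
    "u \<in> U \<Longrightarrow> (\<lambda>x. a * u x) \<in> U"
    "u \<in> U \<Longrightarrow> v \<in> U \<Longrightarrow> (\<lambda>x. u x - v x) \<in> U"
proof -
  show "(\<lambda>x. 0) \<in> U" and 1: "\<And>u v. u \<in> U \<Longrightarrow> v \<in> U \<Longrightarrow> (\<lambda>x. u x + v x) \<in> U"
    and 2: "\<And>a u. u \<in> U \<Longrightarrow> (\<lambda>x. a * u x) \<in> U"
    using assms by (simp_all add: lin_subspace_def)
  assume "u \<in> U" "v \<in> U"
  then show "(\<lambda>x. u x - v x) \<in> U"
    using 1[OF _ 2[of v "- 1"], of u] by simp
qed

text \<open>Orthogonal projection onto a subspace \<open>U\<close> of functions on a finite set, by induction on the set.
  Either all of \<open>U\<close> vanishes at the new point, or \<open>U\<close> is spanned by its members that vanish there and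
  by one vector \<open>e\<close>, which can be taken orthogonal to them. This avoids choosing a basis of \<open>U\<close>.\<close>
lemma orthogonal_decomposition:
  fixes w :: "'b \<Rightarrow> real"
  assumes "finite F" "\<And>x. w x > 0" "lin_subspace U" "\<And>u x. u \<in> U \<Longrightarrow> x \<notin> F \<Longrightarrow> u x = 0"
  shows "\<exists>u\<in>U. \<forall>v\<in>U. (\<Sum>x\<in>F. of_real (w x) * v x * cnj (c x - u x)) = 0"
  using assms(1,3,4)
proof (induction F arbitrary: U c rule: finite_induct)
  case empty
  then show ?case
    using lin_subspaceD(1) by fastforce
next
  case (insert a F)
  note lin = lin_subspaceD[OF insert.prems(1)]
  define ip where "ip v c = (\<Sum>x\<in>insert a F. of_real (w x) * v x * cnj (c x))" for v c :: "'b \<Rightarrow> complex"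
  have ip_lin: "ip (\<lambda>x. u x + v x) c = ip u c + ip v c" "ip (\<lambda>x. t * v x) c = t * ip v c"
    "ip u (\<lambda>x. c x - d x) = ip u c - ip u d" "ip u (\<lambda>x. t * c x) = cnj t * ip u c" for u v c d t
    by (simp_all add: ip_def algebra_simps sum.distrib sum_subtractf sum_distrib_left
        del: sum.insert)
  define U' where "U' = {u \<in> U. u a = 0}"
  have U': "lin_subspace U'"
    using lin by (auto simp: lin_subspace_def U'_def)
  have IH: "\<exists>u\<in>U'. \<forall>v\<in>U'. ip v (\<lambda>x. c x - u x) = 0" for c
  proof -
    have "\<exists>u\<in>U'. \<forall>v\<in>U'. (\<Sum>x\<in>F. of_real (w x) * v x * cnj (c x - u x)) = 0"
    proof (rule insert.IH[OF U'])
      fix u x assume "u \<in> U'" "x \<notin> F"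
      then show "u x = 0"
        using insert.prems(2)[of u x] by (cases "x = a") (auto simp: U'_def)
    qed
    moreover have "ip v d = (\<Sum>x\<in>F. of_real (w x) * v x * cnj (d x))" if "v \<in> U'" for v d
      using that insert.hyps by (simp add: ip_def U'_def)
    ultimately show ?thesis by simp
  qed
  have "\<exists>u\<in>U. \<forall>v\<in>U. ip v (\<lambda>x. c x - u x) = 0"
  proof (cases "U' = U")
    case True
    then show ?thesis using IH by blast
  next
    case False
    then obtain e\<^sub>0 where e\<^sub>0: "e\<^sub>0 \<in> U" "e\<^sub>0 a \<noteq> 0"
      by (auto simp: U'_def)
    obtain u\<^sub>1 where u\<^sub>1: "u\<^sub>1 \<in> U'" "\<And>v. v \<in> U' \<Longrightarrow> ip v (\<lambda>x. e\<^sub>0 x - u\<^sub>1 x) = 0"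
      using IH by blast
    define e where "e = (\<lambda>x. e\<^sub>0 x - u\<^sub>1 x)"
    have e: "e \<in> U" "e a \<noteq> 0" "\<And>v. v \<in> U' \<Longrightarrow> ip v e = 0"
      using e\<^sub>0 u\<^sub>1 lin(4) by (auto simp: e_def U'_def)
    have "ip e e = of_real (\<Sum>x\<in>insert a F. w x * (cmod (e x))\<^sup>2)"
      by (simp add: ip_def mult.assoc del: sum.insert flip: complex_norm_square)
    moreover have "(\<Sum>x\<in>insert a F. w x * (cmod (e x))\<^sup>2) > 0"
      using insert.hyps e(2) assms(2) by (intro sum_pos2[of _ a]) (auto simp: zero_le_mult_iff less_imp_le)
    ultimately have ee: "ip e e \<noteq> 0"
      by (metis of_real_eq_0_iff less_irrefl)
    obtain u\<^sub>2 where u\<^sub>2: "u\<^sub>2 \<in> U'" "\<And>v. v \<in> U' \<Longrightarrow> ip v (\<lambda>x. c x - u\<^sub>2 x) = 0"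
      using IH by blast
    define t where "t = cnj (ip e (\<lambda>x. c x - u\<^sub>2 x) / ip e e)"
    define u where "u = (\<lambda>x. u\<^sub>2 x + t * e x)"
    have ip_u: "ip v (\<lambda>x. c x - u x) = ip v (\<lambda>x. c x - u\<^sub>2 x) - cnj t * ip v e" for v
      unfolding u_def diff_diff_eq[symmetric] ip_lin ..
    have "ip v (\<lambda>x. c x - u x) = 0" if v: "v \<in> U" for v
    proof -
      define v' where "v' = (\<lambda>x. v x - (v a / e a) * e x)"
      have "v' \<in> U'"
        using lin(4)[OF v lin(3)[OF e(1), of "v a / e a"]] e(2) by (simp add: U'_def v'_def)
      then have "ip v' (\<lambda>x. c x - u x) = 0"
        by (simp add: ip_u u\<^sub>2 e)
      moreover have "ip e (\<lambda>x. c x - u x) = 0"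
        using ee by (simp add: ip_u t_def)
      moreover have "v = (\<lambda>x. v' x + (v a / e a) * e x)"
        by (simp add: v'_def)
      ultimately show ?thesis
        using ip_lin(1,2) by (metis add.right_neutral mult_zero_right)
    qed
    moreover have "u \<in> U"
      unfolding u_def using u\<^sub>2(1) e(1) lin by (auto simp: U'_def)
    ultimately show ?thesis by blast
  qed
  then show ?case
    by (simp add: ip_def)
qed

lemma chain_eq_0:
  assumes "c \<in> carrier (simplicial_chains K d)" "K \<subseteq> Pow E" "finite E" "xs \<notin> lists_upto E"
  shows "c xs = 0"
proof (rule ccontr)
  assume "c xs \<noteq> 0"
  then have "distinct xs" "set xs \<subseteq> E"
    using assms(1,2) antisymmetric_eq_0[of c xs] by (auto simp: simplicial_chains_iff)
  then have "length xs \<le> card E"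
    using assms(3) card_mono distinct_card by metis
  then show False
    using \<open>set xs \<subseteq> E\<close> assms(4) by (simp add: lists_upto_def)
qed

lemma pairing_definite:
  assumes c: "c \<in> carrier (simplicial_chains K d)" and K: "K \<subseteq> Pow E" "finite E"
    and 0: "pairing E c (\<lambda>xs. cnj (c xs)) = 0"
  shows "c = (\<lambda>xs. 0)"
proof
  fix xs
  have "pairing E c (\<lambda>xs. cnj (c xs)) =
      of_real (\<Sum>xs\<in>lists_upto E. (cmod (c xs))\<^sup>2 / fact (length xs))"
    by (simp add: pairing_def complex_norm_square del: of_real_power)
  then have "(\<Sum>xs\<in>lists_upto E. (cmod (c xs))\<^sup>2 / fact (length xs)) = 0"
    using 0 by (metis of_real_eq_0_iff)
  then have "\<forall>xs\<in>lists_upto E. (cmod (c xs))\<^sup>2 / fact (length xs) = 0"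
    by (subst (asm) sum_nonneg_eq_0_iff) (auto intro: finite_lists_upto K)
  then show "c xs = 0"
    using chain_eq_0[OF c K, of xs] by auto
qed

lemma chain_orthogonal_decomposition:
  assumes U: "lin_subspace U" "U \<subseteq> carrier (simplicial_chains K d)" and K: "K \<subseteq> Pow E" "finite E"
  obtains u where "u \<in> U" "\<And>v. v \<in> U \<Longrightarrow> pairing E v (\<lambda>xs. cnj (c xs - u xs)) = 0"
proof -
  have "\<exists>u\<in>U. \<forall>v\<in>U. (\<Sum>xs\<in>lists_upto E. of_real (1 / fact (length xs)) * v xs * cnj (c xs - u xs)) = 0"
    by (rule orthogonal_decomposition[OF finite_lists_upto[OF K(2)] _ U(1)])
      (use chain_eq_0[OF _ K] U(2) in auto)
  then show thesis
    using that by (auto simp: pairing_def)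
qed

section \<open>The complementation operator\<close>

text \<open>The Hodge star: up to sign it sends an oriented simplex to the complementary one, where the list
  \<open>es\<close> of all vertices fixes the orientation of the full simplex. The pairing sums over all orderings
  of the complement, so none has to be chosen; \<open>star_apply\<close> evaluates it with any single one.\<close>
definition star :: "'a list \<Rightarrow> ('a list \<Rightarrow> complex) \<Rightarrow> 'a list \<Rightarrow> complex" where
  "star es c ys = pairing (set es) (\<lambda>xs. osimplex es (xs @ ys)) c"

lemma star_lin:
  "star es (\<lambda>xs. b xs + c xs) = (\<lambda>ys. star es b ys + star es c ys)"
  "star es (\<lambda>xs. b xs - c xs) = (\<lambda>ys. star es b ys - star es c ys)"
  "star es (\<lambda>xs. a * c xs) = (\<lambda>ys. a * star es c ys)"
  by (auto simp: star_def pairing_lin)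

lemma star_0: "star es (\<lambda>xs. 0) = (\<lambda>ys. 0)"
  by (auto simp: star_def pairing_def)

lemma antisymmetric_osimplex: "distinct es \<Longrightarrow> antisymmetric (osimplex es)"
  using alternating_osimplex alternating_iff_antisymmetric by blast

lemma osimplex_nonzeroD:
  assumes "distinct es" "osimplex es xs \<noteq> 0"
  shows "set xs = set es" "length xs = length es" "distinct xs"
proof -
  have "mset xs = mset es"
    using assms(2) osimplex_eq_0 by blast
  then show "set xs = set es" "length xs = length es" "distinct xs"
    using assms(1) mset_eq_setD mset_eq_length mset_eq_imp_distinct_iff by blast+
qed

lemma osimplex_square:
  assumes "distinct es" "distinct xs" "set xs = set es"
  shows "osimplex es xs * osimplex es xs = 1"
proof -
  have "mset xs = mset es"
    using assms set_eq_iff_mset_eq_distinct by blast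
  then obtain p :: "nat \<Rightarrow> nat" where "osimplex es xs = of_int (sign p)"
    by (cases rule: osimplex_cases[OF assms(1), of xs, case_names perm zero]) auto
  then show ?thesis
    by (metis of_int_1 of_int_mult sign_idempotent)
qed

lemma star_in_chains:
  assumes es: "distinct es" and c: "c \<in> carrier (simplicial_chains K d)"
  shows "star es c \<in> carrier (simplicial_chains {A. A \<subseteq> set es \<and> set es - A \<in> K} (int (length es) - 2 - d))"
  unfolding simplicial_chains_iff
proof (intro conjI allI impI)
  show "antisymmetric (star es c)"
    unfolding antisymmetric_def
  proof (intro allI)
    fix as x y bs
    have "osimplex es (xs @ as @ x # y # bs) = (- 1) * osimplex es (xs @ as @ y # x # bs)" for xs
      using antisymmetricD[OF antisymmetric_osimplex[OF es], of "xs @ as" x y bs] by simp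
    then show "star es c (as @ x # y # bs) = - star es c (as @ y # x # bs)"
      by (simp only: star_def pairing_lin(3)) simp
  qed
  fix ys assume "star es c ys \<noteq> 0"
  then obtain xs where "osimplex es (xs @ ys) * c xs / fact (length xs) \<noteq> 0"
    unfolding star_def pairing_def by (meson sum.neutral)
  then have xs: "osimplex es (xs @ ys) \<noteq> 0" "c xs \<noteq> 0"
    by auto
  note D = osimplex_nonzeroD[OF es xs(1)]
  have "set es - set ys = set xs"
    using D(1,3) by auto
  then show "set ys \<in> {A. A \<subseteq> set es \<and> set es - A \<in> K}"
    using c xs(2) D(1) by (auto simp: simplicial_chains_iff)
  show "int (length ys) = int (length es) - 2 - d + 1"
    using c xs(2) D(2) by (auto simp: simplicial_chains_iff)
qed

lemma antisymmetric_append: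
  assumes "antisymmetric c"
  shows "antisymmetric (\<lambda>xs. c (xs @ ys))"
  unfolding antisymmetric_def
proof (intro allI)
  fix as x y bs
  show "c ((as @ x # y # bs) @ ys) = - c ((as @ y # x # bs) @ ys)"
    using antisymmetricD[OF assms, of as x y "bs @ ys"] by simp
qed

lemma antisymmetric_perm_mult:
  assumes "antisymmetric b" "antisymmetric c" "mset xs = mset zs"
  shows "b xs * c xs = b zs * c zs"
proof -
  obtain p where p: "p permutes {..<length zs}" "permute_list p zs = xs"
    using mset_eq_permutation[OF assms(3)] by blast
  have "b xs = of_int (sign p) * b zs" "c xs = of_int (sign p) * c zs"
    using assms(1,2) p unfolding alternating_iff_antisymmetric[symmetric] alternating_def by blast+
  moreover have "of_int (sign p) * of_int (sign p) = (1 :: complex)"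
    by (metis of_int_1 of_int_mult sign_idempotent)
  ultimately show ?thesis
    by (simp add: algebra_simps)
qed

text \<open>All orderings \<open>xs\<close> of the complement of \<open>ys\<close> contribute equally, because the signs of \<open>c\<close> and of
  the orientation cancel.\<close>
lemma star_apply:
  assumes es: "distinct es" and c: "antisymmetric c"
    and zs: "distinct zs" and ys: "set ys = set es - set zs"
  assumes "set zs \<subseteq> set es"
  shows "star es c ys = osimplex es (zs @ ys) * c zs"
proof -
  let ?P = "permutations_of_set (set zs)"
  have b: "antisymmetric (\<lambda>xs. osimplex es (xs @ ys))"
    by (rule antisymmetric_append[OF antisymmetric_osimplex[OF es]])
  have card_zs: "length zs = card (set zs)"
    using zs by (simp add: distinct_card)
  have "star es c ys = (\<Sum>xs\<in>?P. osimplex es (xs @ ys) * c xs / fact (length xs))"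
    unfolding star_def pairing_def
  proof (rule sum.mono_neutral_right)
    show "finite (lists_upto (set es))"
      by (simp add: finite_lists_upto)
    have "length xs \<le> card (set es)" if "set xs = set zs" "distinct xs" for xs
      using that assms(5) by (metis card_mono distinct_card finite_set)
    then show "?P \<subseteq> lists_upto (set es)"
      using assms(5) by (auto simp: permutations_of_set_def lists_upto_def)
    have "osimplex es (xs @ ys) = 0" if "xs \<notin> ?P" for xs
    proof (rule ccontr)
      assume "osimplex es (xs @ ys) \<noteq> 0"
      from osimplex_nonzeroD[OF es this] have "set xs = set zs" "distinct xs"
        using ys assms(5) by auto
      then show False
        using that by (simp add: permutations_of_set_def)
    qed
    then show "\<forall>xs\<in>lists_upto (set es) - ?P. osimplex es (xs @ ys) * c xs / fact (length xs) = 0"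
      by simp
  qed
  also have "\<dots> = (\<Sum>xs\<in>?P. osimplex es (zs @ ys) * c zs / fact (length zs))"
  proof (rule sum.cong)
    fix xs assume "xs \<in> ?P"
    then have mset: "mset xs = mset zs"
      using zs set_eq_iff_mset_eq_distinct[of xs zs] by (simp add: permutations_of_set_def)
    show "osimplex es (xs @ ys) * c xs / fact (length xs) =
        osimplex es (zs @ ys) * c zs / fact (length zs)"
      using antisymmetric_perm_mult[OF b c mset] mset_eq_length[OF mset] by simp
  qed simp
  also have "\<dots> = osimplex es (zs @ ys) * c zs"
    by (simp add: card_zs)
  finally show ?thesis .
qed

lemma star_star:
  assumes es: "distinct es" and K: "K \<subseteq> Pow (set es)" and c: "c \<in> carrier (simplicial_chains K d)"
  shows "star es (star es c) =
    (\<lambda>xs. (- 1) ^ (nat (d + 1) * nat (int (length es) - 1 - d)) * c xs)"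
proof
  fix zs
  note star1 = star_in_chains[OF es c]
  show "star es (star es c) zs = (- 1) ^ (nat (d + 1) * nat (int (length es) - 1 - d)) * c zs"
  proof (cases "zs \<in> ordered_faces K d")
    case True
    then have zs: "distinct zs" "set zs \<subseteq> set es" "int (length zs) = d + 1"
      using K by (auto simp: ordered_faces_def)
    \<comment> \<open>Two applications of \<open>star_apply\<close>; the sign is that of exchanging the blocks \<open>ys\<close> and \<open>zs\<close>.\<close>
    obtain ys where ys: "set ys = set es - set zs" "distinct ys"
      using finite_distinct_list[of "set es - set zs"] by blast
    have anti: "antisymmetric c" "antisymmetric (star es c)"
      using c star1 by (simp_all add: simplicial_chains_iff)
    have len: "int (length ys) = int (length es) - 1 - d"
    proof -
      have "length ys = length es - length zs"
        using ys zs(1,2) es card_Diff_subset[of "set zs" "set es"] by (metis distinct_card finite_set)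
      moreover have "length zs \<le> length es"
        using zs(1,2) es card_mono[of "set es" "set zs"] by (simp add: distinct_card)
      ultimately show ?thesis
        using zs(3) by simp
    qed
    have "star es (star es c) zs = osimplex es (ys @ zs) * star es c ys"
      by (rule star_apply[OF es anti(2) ys(2)]) (use ys zs in auto)
    also have "star es c ys = osimplex es (zs @ ys) * c zs"
      by (rule star_apply[OF es anti(1) zs(1) ys(1) zs(2)])
    also have "osimplex es (ys @ zs) = (- 1) ^ (length zs * length ys) * osimplex es (zs @ ys)"
      using antisymmetric_move_block[OF antisymmetric_osimplex[OF es], of ys zs "[]"] by (simp add: mult.commute)
    also have "osimplex es (zs @ ys) * osimplex es (zs @ ys) = 1"
      by (rule osimplex_square[OF es]) (use ys zs in auto)
    then have "(- 1) ^ (length zs * length ys) * osimplex es (zs @ ys) * (osimplex es (zs @ ys) * c zs) =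
        (- 1) ^ (length zs * length ys) * c zs"
      by (simp add: mult.assoc)
    also have "length zs = nat (d + 1)"
      using zs(3) by simp
    also have "length ys = nat (int (length es) - 1 - d)"
      using len by simp
    finally show ?thesis .
  next
    case False
    have "{A. A \<subseteq> set es \<and> set es - A \<in> {A. A \<subseteq> set es \<and> set es - A \<in> K}} = K"
      using K by (auto simp: double_diff)
    then have "star es (star es c) \<in> carrier (simplicial_chains K d)"
      using star_in_chains[OF es star1] by simp
    then show ?thesis
      using False c by (simp add: simplicial_chains_def)
  qed
qed

text \<open>Complementation exchanges dropping a vertex with adding one, so it turns the coboundary into the
  boundary. This is the adjointness of \<open>boundary\<close> and \<open>codiff\<close> applied to the orientation form; the
  sign arises from moving the new vertex past the \<open>d + 1\<close> vertices of the simplex.\<close>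
lemma star_codiff:
  assumes es: "distinct es" and c: "c \<in> carrier (simplicial_chains K d)"
  shows "star es (coboundary (Pow (set es)) c) =
    (\<lambda>ys. (- 1) ^ nat (d + 1) * boundary (Pow (set es)) (star es c) ys)"
proof
  fix ys
  let ?E = "set es"
  let ?b = "\<lambda>xs. osimplex es (xs @ ys)"
  have b: "antisymmetric ?b"
    by (rule antisymmetric_append[OF antisymmetric_osimplex[OF es]])
  have "star es (coboundary (Pow ?E) c) ys = pairing ?E ?b (codiff c)"
    unfolding star_def by (rule pairing_cong) (simp add: coboundary_def)
  also have "\<dots> = pairing ?E (boundary (Pow ?E) ?b) c"
    by (rule pairing_boundary[symmetric, OF _ b]) simp
  also have "\<dots> = pairing ?E (\<lambda>xs. (- 1) ^ nat (d + 1) * (\<Sum>v\<in>?E. osimplex es (xs @ v # ys))) c"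
  proof (rule pairing_cong)
    fix xs
    have "osimplex es (v # xs @ ys) = (- 1) ^ length xs * osimplex es (xs @ v # ys)" for v
      using antisymmetric_move[OF antisymmetric_osimplex[OF es], of "[]" v xs ys] by simp
    then have "boundary (Pow ?E) ?b xs = (- 1) ^ length xs * (\<Sum>v\<in>?E. osimplex es (xs @ v # ys))"
      by (simp add: boundary_Pow sum_distrib_left)
    moreover have "length xs = nat (d + 1)" if "c xs \<noteq> 0"
      using that c by (auto simp: simplicial_chains_iff)
    ultimately show "boundary (Pow ?E) ?b xs * c xs =
        (- 1) ^ nat (d + 1) * (\<Sum>v\<in>?E. osimplex es (xs @ v # ys)) * c xs"
      by (cases "c xs = 0") auto
  qed
  also have "\<dots> = (- 1) ^ nat (d + 1) * pairing ?E (\<lambda>xs. \<Sum>v\<in>?E. osimplex es (xs @ v # ys)) c"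
    by (rule pairing_lin(3))
  also have "pairing ?E (\<lambda>xs. \<Sum>v\<in>?E. osimplex es (xs @ v # ys)) c = boundary (Pow ?E) (star es c) ys"
    unfolding boundary_Pow star_def pairing_def sum_distrib_right sum_divide_distrib by (rule sum.swap)
  finally show "star es (coboundary (Pow ?E) c) ys =
      (- 1) ^ nat (d + 1) * boundary (Pow ?E) (star es c) ys" .
qed

text \<open>Moving \<open>g\<close> to the other argument, the inverse of \<open>g\<close> acts on the entries of \<open>es\<close>. This reorders the
  list by a permutation of positions conjugate to that inverse, whose sign is the sign of \<open>g\<close>.\<close>
lemma osimplex_map:
  assumes es: "distinct es" and g: "g permutes set es"
  shows "osimplex es (map g xs) = of_int (sign g) * osimplex es xs"
proof -
  let ?h = "Hilbert_Choice.inv g"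
  have h: "?h permutes set es"
    using g by (rule permutes_inv)
  have "osimplex es (map g xs) = gact (simplicial_chains UNIV 0) ?h (osimplex es) xs"
    using permutes_inv_inv[OF g] by simp
  also have "\<dots> = osimplex (map ?h es) xs"
    by (simp only: gact_osimplex[OF permutes_bij[OF h]])
  also have "\<dots> = of_int (sign ?h) * osimplex es xs"
  proof -
    have "distinct (map ?h es)"
      using es permutes_inj_on[OF h] by (simp add: distinct_map)
    moreover have "set (map ?h es) = set es"
      using permutes_image[OF h] by simp
    ultimately have "mset (map ?h es) = mset es"
      using es set_eq_iff_mset_eq_distinct by blast
    then obtain p where p: "p permutes {..<length es}" "permute_list p es = map ?h es"
      by (rule mset_eq_permutation)
    have inj: "inj_on ((!) es) {..<length es}"
      using es by (simp add: inj_on_nth)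
    have "?h = map_permutation {..<length es} ((!) es) p"
    proof
      fix x
      have q: "map_permutation {..<length es} ((!) es) p permutes (!) es ` {..<length es}"
        by (rule map_permutation_permutes) (use p inj in \<open>auto simp: inj_on_imp_bij_betw\<close>)
      have img: "(!) es ` {..<length es} = set es"
        by (auto simp: set_conv_nth)
      show "?h x = map_permutation {..<length es} ((!) es) p x"
      proof (cases "x \<in> set es")
        case True
        then obtain i where i: "i < length es" "x = es ! i"
          by (auto simp: in_set_conv_nth)
        have "?h x = map ?h es ! i"
          using i by simp
        also have "\<dots> = es ! p i"
          using p i by (simp flip: p(2) add: permute_list_nth)
        also have "\<dots> = map_permutation {..<length es} ((!) es) p x"
          using map_permutation_apply[OF inj, of i p] i by simp
        finally show ?thesis .
      next
        case False
        then show ?thesis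
          using permutes_not_in[OF h] permutes_not_in[OF q] img by simp
      qed
    qed
    then have "sign ?h = sign p"
      using sign_map_permutation[OF inj p(1)] by simp
    then show ?thesis
      using osimplex_permute[OF es p(1)] p(2) by simp
  qed
  also have "sign ?h = sign g"
    using g by (intro sign_inverse permutation_permutes[THEN iffD2]) auto
  finally show ?thesis .
qed

text \<open>The orientation of the full simplex spans the sign representation; this is where the twist by
  \<open>sgn\<close> comes from.\<close>
lemma star_map:
  assumes es: "distinct es" and g: "g permutes set es"
  shows "star es (\<lambda>xs. c (map (Hilbert_Choice.inv g) xs)) =
    (\<lambda>ys. of_int (sign g) * star es c (map (Hilbert_Choice.inv g) ys))"
proof
  fix ys
  let ?h = "Hilbert_Choice.inv g" and ?F = "lists_upto (set es)"
  have gh: "map g (map ?h xs) = xs" "map ?h (map g xs) = xs" for xs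
    using permutes_inverses[OF g] by (simp_all add: o_def)
  have F: "map k xs \<in> ?F" if "k permutes set es" "xs \<in> ?F" for k xs
    using that permutes_in_image[OF that(1)] by (auto simp: lists_upto_def)
  have "bij_betw (map g) ?F ?F"
    by (rule bij_betw_byWitness[of _ "map ?h"])
      (use F[OF g] F[OF permutes_inv[OF g]] gh in auto)
  then have "star es (\<lambda>xs. c (map ?h xs)) ys =
      (\<Sum>xs\<in>?F. osimplex es (map g xs @ ys) * c (map ?h (map g xs)) / fact (length (map g xs)))"
    unfolding star_def pairing_def by (rule sum.reindex_bij_betw[symmetric])
  also have "\<dots> = (\<Sum>xs\<in>?F. of_int (sign g) * (osimplex es (xs @ map ?h ys) * c xs / fact (length xs)))"
  proof (rule sum.cong)
    fix xs
    have "osimplex es (map g xs @ ys) = of_int (sign g) * osimplex es (xs @ map ?h ys)"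
      using osimplex_map[OF es g, of "xs @ map ?h ys"] by (simp only: map_append gh)
    then show "osimplex es (map g xs @ ys) * c (map ?h (map g xs)) / fact (length (map g xs)) =
        of_int (sign g) * (osimplex es (xs @ map ?h ys) * c xs / fact (length xs))"
      by (simp only: gh length_map times_divide_eq_right mult.assoc)
  qed simp
  also have "\<dots> = of_int (sign g) * star es c (map ?h ys)"
    by (simp add: star_def pairing_def sum_distrib_left)
  finally show "star es (\<lambda>xs. c (map ?h xs)) ys = of_int (sign g) * star es c (map ?h ys)" .
qed

section \<open>Homology classes\<close>

lemma boundary_lin:
  "boundary K (\<lambda>xs. b xs + c xs) = (\<lambda>xs. boundary K b xs + boundary K c xs)"
  "boundary K (\<lambda>xs. b xs - c xs) = (\<lambda>xs. boundary K b xs - boundary K c xs)"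
  "boundary K (\<lambda>xs. a * c xs) = (\<lambda>xs. a * boundary K c xs)"
  "boundary K (\<lambda>xs. 0) = (\<lambda>xs. 0)"
  "boundary K (\<lambda>xs. cnj (c xs)) = (\<lambda>xs. cnj (boundary K c xs))"
  by (auto simp: boundary_def sum.distrib sum_subtractf sum_distrib_left)

lemma lin_subspace_chains: "lin_subspace (carrier (simplicial_chains K d))"
proof -
  have "alternating (\<lambda>xs. b xs + c xs)" if "alternating b" "alternating c" for b c :: "'a list \<Rightarrow> complex"
    using that unfolding alternating_def by (metis distrib_left)
  moreover have "alternating (\<lambda>xs. a * c xs)" if "alternating c" for a and c :: "'a list \<Rightarrow> complex"
    using that unfolding alternating_def by (metis mult.left_commute)
  moreover have "alternating (\<lambda>xs::'a list. 0)"
    by (simp add: alternating_def)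
  ultimately show ?thesis
    unfolding lin_subspace_def simplicial_chains_def by simp
qed

lemma lin_subspace_cycles: "lin_subspace (cycles K d)"
  using lin_subspaceD(1-3)[OF lin_subspace_chains[of K d]]
  by (simp add: lin_subspace_def cycles_def boundary_lin)

lemma lin_subspace_image:
  assumes U: "lin_subspace U"
    and f: "\<And>u v. f (\<lambda>x. u x + v x) = (\<lambda>x. f u x + f v x)" "\<And>a u. f (\<lambda>x. a * u x) = (\<lambda>x. a * f u x)"
  shows "lin_subspace (f ` U)"
  unfolding lin_subspace_def
proof (intro conjI ballI allI)
  have "f (\<lambda>x. 0) = (\<lambda>x. 0)"
    using f(2)[of 0 "\<lambda>x. 0"] by simp
  then show "(\<lambda>x. 0) \<in> f ` U"
    using lin_subspaceD(1)[OF U] by (metis imageI)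
  fix a u assume "u \<in> f ` U"
  then obtain u' where u: "u' \<in> U" "u = f u'" by blast
  show "(\<lambda>x. a * u x) \<in> f ` U"
    by (rule rev_image_eqI[OF lin_subspaceD(3)[OF U u(1)]]) (simp only: u(2) f(2))
  fix v assume "v \<in> f ` U"
  then obtain v' where v: "v' \<in> U" "v = f v'" by blast
  show "(\<lambda>x. u x + v x) \<in> f ` U"
    by (rule rev_image_eqI[OF lin_subspaceD(2)[OF U u(1) v(1)]]) (simp only: u(2) v(2) f(1))
qed

lemma lin_subspace_boundaries: "lin_subspace (boundaries K d)"
  unfolding boundaries_def
  by (rule lin_subspace_image[OF lin_subspace_chains]) (simp_all add: boundary_lin)

definition homology_class :: "'a set set \<Rightarrow> int \<Rightarrow> ('a list \<Rightarrow> complex) \<Rightarrow> ('a list \<Rightarrow> complex) set" where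
  "homology_class K d c = (\<lambda>b xs. b xs + c xs) ` boundaries K d"

lemma homology_class_iff: "z \<in> homology_class K d c \<longleftrightarrow> (\<lambda>xs. z xs - c xs) \<in> boundaries K d"
proof
  assume "(\<lambda>xs. z xs - c xs) \<in> boundaries K d"
  then show "z \<in> homology_class K d c"
    unfolding homology_class_def by (rule rev_image_eqI) simp
qed (auto simp: homology_class_def)

lemma homology_class_eq_iff:
  "homology_class K d b = homology_class K d c \<longleftrightarrow> (\<lambda>xs. b xs - c xs) \<in> boundaries K d"
proof
  note lin = lin_subspaceD[OF lin_subspace_boundaries[of K d]]
  show "(\<lambda>xs. b xs - c xs) \<in> boundaries K d" if "homology_class K d b = homology_class K d c"
  proof -
    have "b \<in> homology_class K d b"
      using lin(1) by (simp add: homology_class_iff)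
    then show ?thesis
      unfolding that homology_class_iff .
  qed
  assume bc: "(\<lambda>xs. b xs - c xs) \<in> boundaries K d"
  show "homology_class K d b = homology_class K d c"
  proof (intro Set.set_eqI iffI)
    fix z
    show "z \<in> homology_class K d c" if "z \<in> homology_class K d b"
      using lin(2)[OF that[unfolded homology_class_iff] bc] by (simp add: homology_class_iff)
    show "z \<in> homology_class K d b" if "z \<in> homology_class K d c"
      using lin(4)[OF that[unfolded homology_class_iff] bc] by (simp add: homology_class_iff)
  qed
qed

lemma
  shows carrier_reduced_homology: "carrier (reduced_homology K d) = homology_class K d ` cycles K d"
    and add_reduced_homology: "homology_class K d b \<oplus>\<^bsub>reduced_homology K d\<^esub> homology_class K d c =
      homology_class K d (\<lambda>xs. b xs + c xs)"
    and smult_reduced_homology: "a \<odot>\<^bsub>reduced_homology K d\<^esub> homology_class K d c =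
      homology_class K d (\<lambda>xs. a * c xs)"
    and gact_reduced_homology: "(\<lambda>c xs. c (map (Hilbert_Choice.inv g) xs)) ` boundaries K d = boundaries K d \<Longrightarrow>
      gact (reduced_homology K d) g (homology_class K d c) =
      homology_class K d (\<lambda>xs. c (map (Hilbert_Choice.inv g) xs))"
proof -
  note lin = lin_subspaceD[OF lin_subspace_boundaries[of K d]]
  let ?Z = "(simplicial_chains K d)\<lparr>carrier := cycles K d\<rparr>"
  have cl: "boundaries K d +>\<^bsub>?Z\<^esub> c = homology_class K d c" for c
    by (auto simp: a_r_coset_def' homology_class_def)
  show "carrier (reduced_homology K d) = homology_class K d ` cycles K d"
    by (auto simp: reduced_homology_def quotient_module_def A_RCOSETS_def' cl)
  show "homology_class K d b \<oplus>\<^bsub>reduced_homology K d\<^esub> homology_class K d c =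
      homology_class K d (\<lambda>xs. b xs + c xs)"
  proof (intro Set.set_eqI iffI)
    fix z assume "z \<in> homology_class K d b \<oplus>\<^bsub>reduced_homology K d\<^esub> homology_class K d c"
    then obtain u v where "u \<in> boundaries K d" "v \<in> boundaries K d"
      "z = (\<lambda>xs. (u xs + b xs) + (v xs + c xs))"
      by (auto simp: reduced_homology_def quotient_module_def set_add_def' homology_class_def)
    then show "z \<in> homology_class K d (\<lambda>xs. b xs + c xs)"
      using lin(2)[of u v] by (simp add: homology_class_iff)
  next
    fix z assume "z \<in> homology_class K d (\<lambda>xs. b xs + c xs)"
    then have "(\<lambda>xs. z xs - c xs) \<in> homology_class K d b"
      by (simp add: homology_class_iff algebra_simps)
    moreover have "c \<in> homology_class K d c"
      using lin(1) by (simp add: homology_class_iff)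
    moreover have "z = (\<lambda>xs. (z xs - c xs) + c xs)"
      by simp
    ultimately have "\<exists>x\<in>homology_class K d b. \<exists>y\<in>homology_class K d c. z = (\<lambda>xs. x xs + y xs)"
      by (intro bexI)
    then show "z \<in> homology_class K d b \<oplus>\<^bsub>reduced_homology K d\<^esub> homology_class K d c"
      by (auto simp: reduced_homology_def quotient_module_def set_add_def')
  qed
  show "a \<odot>\<^bsub>reduced_homology K d\<^esub> homology_class K d c = homology_class K d (\<lambda>xs. a * c xs)"
  proof -
    have "homology_class K d (\<lambda>xs. a * x xs) = homology_class K d (\<lambda>xs. a * c xs)"
      if "x \<in> homology_class K d c" for x
      using lin(3)[OF that[unfolded homology_class_iff], of a]
      by (simp add: homology_class_eq_iff right_diff_distrib)
    moreover have "c \<in> homology_class K d c"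
      using lin(1) by (simp add: homology_class_iff)
    ultimately have "(\<Union>x\<in>homology_class K d c. homology_class K d (\<lambda>xs. a * x xs)) =
        homology_class K d (\<lambda>xs. a * c xs)"
      by blast
    then show ?thesis
      by (simp add: reduced_homology_def quotient_module_def cl)
  qed
  show "gact (reduced_homology K d) g (homology_class K d c) =
      homology_class K d (\<lambda>xs. c (map (Hilbert_Choice.inv g) xs))"
    if B: "(\<lambda>c xs. c (map (Hilbert_Choice.inv g) xs)) ` boundaries K d = boundaries K d"
  proof -
    have "gact (reduced_homology K d) g (homology_class K d c) =
        (\<lambda>b xs. b xs + c (map (Hilbert_Choice.inv g) xs)) `
          (\<lambda>c xs. c (map (Hilbert_Choice.inv g) xs)) ` boundaries K d"
      by (simp add: reduced_homology_def quotient_module_def homology_class_def image_image)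
    then show ?thesis
      unfolding B homology_class_def .
  qed
qed

text \<open>If a space \<open>H\<close> of cycles maps onto two homology spaces with the same kernel, these are isomorphic.
  So a map between homology spaces can be described on convenient representatives, without being
  defined on all cycles. A twist \<open>\<chi>\<close> with values \<open>1\<close> and \<open>- 1\<close> may be put on either side.\<close>
lemma cg_isomorphic_reduced_homologyI:
  assumes H: "lin_subspace H" "H \<subseteq> cycles K d"
    and f: "\<And>h. h \<in> H \<Longrightarrow> f h \<in> cycles L e"
    and f_add: "\<And>h k. f (\<lambda>xs. h xs + k xs) = (\<lambda>xs. f h xs + f k xs)"
    and f_smult: "\<And>a h. f (\<lambda>xs. a * h xs) = (\<lambda>xs. a * f h xs)"
    and gH: "\<And>g h. g \<in> carrier G \<Longrightarrow> h \<in> H \<Longrightarrow> (\<lambda>xs. h (map (Hilbert_Choice.inv g) xs)) \<in> H"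
    and f_gact: "\<And>g h. g \<in> carrier G \<Longrightarrow> h \<in> H \<Longrightarrow>
      f (\<lambda>xs. h (map (Hilbert_Choice.inv g) xs)) = (\<lambda>xs. \<chi> g * f h (map (Hilbert_Choice.inv g) xs))"
    and \<chi>: "\<And>g. g \<in> carrier G \<Longrightarrow> \<chi> g * \<chi> g = 1"
    and gL: "\<And>g. g \<in> carrier G \<Longrightarrow>
      (\<lambda>c xs. c (map (Hilbert_Choice.inv g) xs)) ` boundaries L e = boundaries L e"
    and gK: "\<And>g. g \<in> carrier G \<Longrightarrow>
      (\<lambda>c xs. c (map (Hilbert_Choice.inv g) xs)) ` boundaries K d = boundaries K d"
    and surj_L: "\<And>z. z \<in> cycles L e \<Longrightarrow> \<exists>h\<in>H. (\<lambda>xs. z xs - f h xs) \<in> boundaries L e"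
    and surj_K: "\<And>c. c \<in> cycles K d \<Longrightarrow> \<exists>h\<in>H. (\<lambda>xs. c xs - h xs) \<in> boundaries K d"
    and ker: "\<And>h. h \<in> H \<Longrightarrow> f h \<in> boundaries L e \<longleftrightarrow> h \<in> boundaries K d"
  shows "cg_isomorphic G (reduced_homology L e) (tensor_character (reduced_homology K d) \<chi>)"
proof -
  note lin = lin_subspaceD[OF H(1)]
  let ?V = "reduced_homology L e" and ?W = "reduced_homology K d"
  have f_diff: "f (\<lambda>xs. h xs - k xs) = (\<lambda>xs. f h xs - f k xs)" for h k
    using f_add[of h "\<lambda>xs. (- 1) * k xs"] f_smult[of "- 1" k] by simp
  have V: "carrier ?V = (\<lambda>h. homology_class L e (f h)) ` H"
    unfolding carrier_reduced_homology using f surj_L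
    by (auto simp: image_iff homology_class_eq_iff)
  have W: "carrier ?W = homology_class K d ` H"
    unfolding carrier_reduced_homology using H(2) surj_K
    by (auto simp: image_iff homology_class_eq_iff)
  have eq_iff: "homology_class L e (f h) = homology_class L e (f k) \<longleftrightarrow>
      homology_class K d h = homology_class K d k" if "h \<in> H" "k \<in> H" for h k
    using ker[OF lin(4)[OF that]] by (simp add: homology_class_eq_iff f_diff)
  define F where "F S = homology_class K d (SOME h. h \<in> H \<and> homology_class L e (f h) = S)" for S
  have F: "F (homology_class L e (f h)) = homology_class K d h" if h: "h \<in> H" for h
  proof -
    let ?h = "SOME k. k \<in> H \<and> homology_class L e (f k) = homology_class L e (f h)"
    have "?h \<in> H \<and> homology_class L e (f ?h) = homology_class L e (f h)"
      by (rule someI[of _ h]) (use h in simp)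
    then show ?thesis
      using eq_iff[of ?h h] h by (simp add: F_def)
  qed
  have iso: "F \<in> iso (add_monoid ?V) (add_monoid (tensor_character ?W \<chi>))"
  proof (rule isoI)
    show "F \<in> hom (add_monoid ?V) (add_monoid (tensor_character ?W \<chi>))"
    proof (rule homI)
      show "F S \<in> carrier (add_monoid (tensor_character ?W \<chi>))"
        if "S \<in> carrier (add_monoid ?V)" for S
        using that by (auto simp: V W F)
      show "F (S \<otimes>\<^bsub>add_monoid ?V\<^esub> T) = F S \<otimes>\<^bsub>add_monoid (tensor_character ?W \<chi>)\<^esub> F T"
        if S: "S \<in> carrier (add_monoid ?V)" and T: "T \<in> carrier (add_monoid ?V)" for S T
      proof -
        obtain h k where hk: "h \<in> H" "S = homology_class L e (f h)" "k \<in> H" "T = homology_class L e (f k)"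
          using S T by (auto simp: V)
        have "S \<oplus>\<^bsub>?V\<^esub> T = homology_class L e (f (\<lambda>xs. h xs + k xs))"
          by (simp add: hk add_reduced_homology f_add)
        then show ?thesis
          by (simp add: hk F lin(2) add_reduced_homology)
      qed
    qed
    show "bij_betw F (carrier (add_monoid ?V)) (carrier (add_monoid (tensor_character ?W \<chi>)))"
    proof (rule bij_betw_imageI)
      show "inj_on F (carrier (add_monoid ?V))"
        by (auto simp: V inj_on_def F eq_iff)
      show "F ` carrier (add_monoid ?V) = carrier (add_monoid (tensor_character ?W \<chi>))"
        by (simp add: V W image_image F)
    qed
  qed
  have smult: "F (a \<odot>\<^bsub>?V\<^esub> S) = a \<odot>\<^bsub>tensor_character ?W \<chi>\<^esub> F S" if "S \<in> carrier ?V" for a S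
  proof -
    obtain h where h: "h \<in> H" "S = homology_class L e (f h)"
      using \<open>S \<in> carrier ?V\<close> by (auto simp: V)
    have "a \<odot>\<^bsub>?V\<^esub> S = homology_class L e (f (\<lambda>xs. a * h xs))"
      by (simp add: h smult_reduced_homology f_smult)
    then show ?thesis
      by (simp add: h F lin(3) smult_reduced_homology)
  qed
  have gact: "F (gact ?V g S) = gact (tensor_character ?W \<chi>) g (F S)"
    if g: "g \<in> carrier G" and "S \<in> carrier ?V" for g S
  proof -
    obtain h where h: "h \<in> H" "S = homology_class L e (f h)"
      using \<open>S \<in> carrier ?V\<close> by (auto simp: V)
    let ?k = "\<lambda>xs. \<chi> g * h (map (Hilbert_Choice.inv g) xs)"
    have "?k \<in> H"
      by (rule lin(3)[OF gH[OF g h(1)]])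
    have "f ?k = (\<lambda>xs. \<chi> g * (\<chi> g * f h (map (Hilbert_Choice.inv g) xs)))"
      by (simp only: f_smult f_gact[OF g h(1)])
    also have "\<dots> = (\<lambda>xs. f h (map (Hilbert_Choice.inv g) xs))"
      using \<chi>[OF g] by (simp flip: mult.assoc)
    finally have "gact ?V g S = homology_class L e (f ?k)"
      by (simp add: h gact_reduced_homology[OF gL[OF g]])
    then have "F (gact ?V g S) = homology_class K d ?k"
      using F[OF \<open>?k \<in> H\<close>] by simp
    then show ?thesis
      by (simp add: h F gact_reduced_homology[OF gK[OF g]] smult_reduced_homology)
  qed
  show ?thesis
    unfolding cg_isomorphic_def by (intro bexI[OF _ iso] conjI allI ballI smult gact)
qed

lemma antisymmetric_map:
  assumes "antisymmetric c"
  shows "antisymmetric (\<lambda>xs. c (map f xs))"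
  unfolding antisymmetric_def
proof (intro allI)
  fix as x y bs
  show "c (map f (as @ x # y # bs)) = - c (map f (as @ y # x # bs))"
    using antisymmetricD[OF assms, of "map f as" "f x" "f y" "map f bs"] by simp
qed

lemma gact_chains:
  assumes "bij g" and K: "\<And>A. g ` A \<in> K \<longleftrightarrow> A \<in> K"
  shows "(\<lambda>c xs. c (map (Hilbert_Choice.inv g) xs)) ` carrier (simplicial_chains K d) =
    carrier (simplicial_chains K d)"
proof (intro equalityI subsetI)
  let ?act = "\<lambda>c xs. c (map (Hilbert_Choice.inv g) xs)"
  have inv: "g (Hilbert_Choice.inv g x) = x" "Hilbert_Choice.inv g (g x) = x" for x
    using assms(1) by (simp_all add: bij_is_surj surj_f_inv_f bij_is_inj)
  have K': "set (map (Hilbert_Choice.inv g) xs) \<in> K \<longleftrightarrow> set xs \<in> K" "set (map g xs) \<in> K \<longleftrightarrow> set xs \<in> K" for xs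
    using K[of "set (map (Hilbert_Choice.inv g) xs)"] K[of "set xs"] by (simp_all add: image_image inv)
  have closed: "(\<lambda>xs. c (map f xs)) \<in> carrier (simplicial_chains K d)"
    if "c \<in> carrier (simplicial_chains K d)" "\<And>xs. set (map f xs) \<in> K \<longleftrightarrow> set xs \<in> K" for c f
    unfolding simplicial_chains_iff
  proof (intro conjI allI impI)
    show "antisymmetric (\<lambda>xs. c (map f xs))"
      by (rule antisymmetric_map) (use that(1) in \<open>simp add: simplicial_chains_iff\<close>)
    fix xs assume "c (map f xs) \<noteq> 0"
    then have "set (map f xs) \<in> K \<and> int (length (map f xs)) = d + 1"
      using that(1) unfolding simplicial_chains_iff by blast
    then show "set xs \<in> K" "int (length xs) = d + 1"
      unfolding that(2) by simp_all
  qed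
  show "c \<in> carrier (simplicial_chains K d)" if "c \<in> ?act ` carrier (simplicial_chains K d)" for c
    using that closed[OF _ K'(1)] by blast
  fix c assume c: "c \<in> carrier (simplicial_chains K d)"
  from closed[OF c K'(2)] show "c \<in> ?act ` carrier (simplicial_chains K d)"
    by (rule rev_image_eqI) (simp add: o_def inv)
qed

lemma image_Union_invariant:
  assumes "bij g" and K: "\<And>A. g ` A \<in> K \<longleftrightarrow> A \<in> K"
  shows "g ` \<Union>K = \<Union>K"
proof (intro equalityI subsetI)
  fix x assume "x \<in> \<Union>K"
  then obtain A where A: "x \<in> A" "A \<in> K" by blast
  have gA: "g ` Hilbert_Choice.inv g ` A = A"
    using assms(1) by (simp add: bij_is_surj image_f_inv_f)
  then have "Hilbert_Choice.inv g ` A \<in> K"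
    using K[of "Hilbert_Choice.inv g ` A"] A(2) by simp
  then have "g ` Hilbert_Choice.inv g ` A \<subseteq> g ` \<Union>K"
    by (intro image_mono) blast
  then show "x \<in> g ` \<Union>K"
    using A(1) unfolding gA by blast
next
  fix x assume "x \<in> g ` \<Union>K"
  then obtain A where A: "x \<in> g ` A" "A \<in> K" by blast
  then show "x \<in> \<Union>K"
    using K[of A] by blast
qed

lemma gact_boundaries:
  assumes "bij g" and K: "\<And>A. g ` A \<in> K \<longleftrightarrow> A \<in> K"
  shows "(\<lambda>c xs. c (map (Hilbert_Choice.inv g) xs)) ` boundaries K d = boundaries K d"
proof -
  let ?act = "\<lambda>c xs. c (map (Hilbert_Choice.inv g) xs)"
  have "boundary K (?act c) = ?act (boundary K c)" for c
    using boundary_gact[OF assms(1) image_Union_invariant[OF assms]] by simp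
  then have "?act ` boundaries K d = boundary K ` ?act ` carrier (simplicial_chains K (d + 1))"
    by (simp add: boundaries_def image_image)
  then show ?thesis
    by (simp only: gact_chains[OF assms] boundaries_def)
qed

section \<open>Harmonic cycles\<close>

lemma chains_mono: "K \<subseteq> K' \<Longrightarrow> c \<in> carrier (simplicial_chains K d) \<Longrightarrow> c \<in> carrier (simplicial_chains K' d)"
  by (auto simp: simplicial_chains_iff)

lemma chains_cnj: "c \<in> carrier (simplicial_chains K d) \<Longrightarrow> (\<lambda>xs. cnj (c xs)) \<in> carrier (simplicial_chains K d)"
  by (simp add: simplicial_chains_def alternating_def)

lemma chain_nonzeroD:
  assumes "c \<in> carrier (simplicial_chains K d)" "c xs \<noteq> 0"
  shows "set xs \<in> K" "int (length xs) = d + 1"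
  using assms unfolding simplicial_chains_iff by blast+

lemma boundary_eq_boundary_Pow:
  assumes "c \<in> carrier (simplicial_chains K d)" "K \<subseteq> Pow E" "finite E"
  shows "boundary K c = boundary (Pow E) c"
proof
  fix xs
  have "c (v # xs) = 0" if "v \<notin> \<Union>K" for v
    using that chain_nonzeroD(1)[OF assms(1), of "v # xs"] by auto
  then show "boundary K c xs = boundary (Pow E) c xs"
    unfolding boundary_Pow boundary_def
    by (intro sum.mono_neutral_left) (use assms in auto)
qed

text \<open>The vertices of \<open>K\<close> need not exhaust \<open>E\<close>, as the Alexander dual refers to the ambient set.\<close>
locale simplicial_complex_on =
  fixes E :: "'a set" and K :: "'a set set"
  assumes finite_E: "finite E"
    and K_sub: "K \<subseteq> Pow E"
    and down: "A \<in> K \<Longrightarrow> B \<subseteq> A \<Longrightarrow> B \<in> K"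
begin

lemma boundary_in_chains:
  assumes "c \<in> carrier (simplicial_chains K (d + 1))"
  shows "boundary K c \<in> carrier (simplicial_chains K d)" "boundary K (boundary K c) = (\<lambda>xs. 0)"
proof -
  have "boundary K c \<in> cycles K d"
    by (rule boundary_in_cycles) (use assms finite_E K_sub down in \<open>auto intro: finite_subset\<close>)
  then show "boundary K c \<in> carrier (simplicial_chains K d)" "boundary K (boundary K c) = (\<lambda>xs. 0)"
    by (simp_all add: cycles_def)
qed

lemma chain_restrict_chain:
  assumes "c \<in> carrier (simplicial_chains K d)"
  shows "chain_restrict K c = c"
proof
  fix xs
  show "chain_restrict K c xs = c xs"
    using chain_nonzeroD[OF assms, of xs] by (auto simp: chain_restrict_def)
qed

text \<open>Against a chain of \<open>K\<close> only the values of \<open>codiff c\<close> on faces of \<open>K\<close> count.\<close>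
lemma pairing_boundary_chain:
  assumes "b \<in> carrier (simplicial_chains K d)"
  shows "pairing E (boundary K b) c = pairing E b (coboundary K c)"
proof -
  have "pairing E (boundary K b) c = pairing E b (codiff c)"
    using assms unfolding boundary_eq_boundary_Pow[OF assms K_sub finite_E]
    by (intro pairing_boundary[OF finite_E]) (simp add: simplicial_chains_iff)
  also have "\<dots> = pairing E b (coboundary K c)"
    by (rule pairing_cong) (use assms in \<open>auto simp: coboundary_def simplicial_chains_iff\<close>)
  finally show ?thesis .
qed

lemma pairing_commute: "pairing E b c = pairing E c b"
  by (simp add: pairing_def mult.commute)

lemma coboundary_cnj: "coboundary K (\<lambda>xs. cnj (c xs)) = (\<lambda>xs. cnj (coboundary K c xs))"
  by (auto simp: coboundary_def codiff_lin)

text \<open>Being both cycles and cocycles, harmonic chains represent homology and cohomology classes at once.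
  This makes \<open>H\<^sub>d\<close> and \<open>H\<^sup>d\<close> isomorphic as representations, where evaluation of cochains on chains
  would only identify \<open>H\<^sup>d\<close> with the dual of \<open>H\<^sub>d\<close>.\<close>
definition harmonic :: "int \<Rightarrow> ('a list \<Rightarrow> complex) set" where
  "harmonic d = {h \<in> cycles K d. coboundary K h = (\<lambda>xs. 0)}"

lemma harmonicD:
  assumes "h \<in> harmonic d"
  shows "h \<in> carrier (simplicial_chains K d)" "boundary K h = (\<lambda>xs. 0)" "coboundary K h = (\<lambda>xs. 0)"
  using assms by (auto simp: harmonic_def cycles_def)

lemma lin_subspace_harmonic: "lin_subspace (harmonic d)"
  using lin_subspaceD[OF lin_subspace_cycles[of K d]]
  by (auto simp: lin_subspace_def harmonic_def coboundary_lin)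

text \<open>Such an \<open>h\<close> is orthogonal to itself: \<open>\<langle>h, \<delta>b\<rangle> = \<langle>\<partial>h, b\<rangle> = 0\<close>.\<close>
lemma harmonic_coboundary_eq_0:
  assumes h: "h \<in> harmonic d" "h = coboundary K b"
  shows "h = (\<lambda>xs. 0)"
proof (rule pairing_definite[OF harmonicD(1)[OF h(1)] K_sub finite_E])
  have "pairing E h (\<lambda>xs. cnj (h xs)) = pairing E (\<lambda>xs. cnj (h xs)) (coboundary K b)"
    using h(2) pairing_commute by metis
  also have "\<dots> = pairing E (boundary K (\<lambda>xs. cnj (h xs))) b"
    by (rule pairing_boundary_chain[symmetric, OF chains_cnj[OF harmonicD(1)[OF h(1)]]])
  also have "\<dots> = 0"
    by (simp add: boundary_lin harmonicD(2)[OF h(1)] pairing_def)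
  finally show "pairing E h (\<lambda>xs. cnj (h xs)) = 0" .
qed

lemma harmonic_boundary_eq_0:
  assumes h: "h \<in> harmonic d" "h \<in> boundaries K d"
  shows "h = (\<lambda>xs. 0)"
proof (rule pairing_definite[OF harmonicD(1)[OF h(1)] K_sub finite_E])
  obtain b where b: "b \<in> carrier (simplicial_chains K (d + 1))" "h = boundary K b"
    using h(2) by (auto simp: boundaries_def)
  have "pairing E h (\<lambda>xs. cnj (h xs)) = pairing E b (coboundary K (\<lambda>xs. cnj (h xs)))"
    using pairing_boundary_chain[OF b(1)] b(2) by simp
  also have "\<dots> = 0"
    by (simp add: coboundary_cnj harmonicD(3)[OF h(1)] pairing_def)
  finally show "pairing E h (\<lambda>xs. cnj (h xs)) = 0" .
qed

lemma boundaries_sub_cycles: "boundaries K d \<subseteq> cycles K d"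
  using boundary_in_chains by (auto simp: boundaries_def cycles_def)

text \<open>The part \<open>h\<close> of a cycle orthogonal to all boundaries is again a cycle, and it is a cocycle, because
  \<open>\<langle>\<delta>h, \<delta>h\<rangle> = \<langle>h, \<partial>\<delta>h\<rangle> = 0\<close>.\<close>
lemma cycle_homologous_harmonic:
  assumes c: "c \<in> cycles K d"
  obtains h where "h \<in> harmonic d" "(\<lambda>xs. c xs - h xs) \<in> boundaries K d"
proof -
  have "boundaries K d \<subseteq> carrier (simplicial_chains K d)"
    using boundaries_sub_cycles by (auto simp: cycles_def)
  then obtain u where u: "u \<in> boundaries K d"
    and orth: "\<And>v. v \<in> boundaries K d \<Longrightarrow> pairing E v (\<lambda>xs. cnj (c xs - u xs)) = 0"
    using chain_orthogonal_decomposition[OF lin_subspace_boundaries _ K_sub finite_E, of K d d c] by blast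
  define h where "h = (\<lambda>xs. c xs - u xs)"
  have h: "h \<in> cycles K d"
    unfolding h_def using lin_subspaceD(4)[OF lin_subspace_cycles c] u boundaries_sub_cycles by blast
  have w: "coboundary K h \<in> carrier (simplicial_chains K (d + 1))"
    by (rule coboundary_in_chains[where L = K]) (use h in \<open>simp add: cycles_def\<close>)
  have "coboundary K h = (\<lambda>xs. 0)"
  proof (rule pairing_definite[OF w K_sub finite_E])
    have "pairing E (coboundary K h) (\<lambda>xs. cnj (coboundary K h xs)) =
        pairing E (boundary K (coboundary K h)) (\<lambda>xs. cnj (h xs))"
      by (simp add: pairing_boundary_chain[OF w] coboundary_cnj)
    also have "\<dots> = 0"
      unfolding h_def by (rule orth[folded h_def]) (use w in \<open>simp add: boundaries_def h_def\<close>)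
    finally show "pairing E (coboundary K h) (\<lambda>xs. cnj (coboundary K h xs)) = 0" .
  qed
  then have "h \<in> harmonic d"
    using h by (simp add: harmonic_def)
  moreover have "(\<lambda>xs. c xs - h xs) \<in> boundaries K d"
    using u by (simp add: h_def)
  ultimately show thesis by (rule that)
qed

text \<open>The mirror image: the part orthogonal to all coboundaries is annihilated by the boundary.\<close>
lemma cocycle_cohomologous_harmonic:
  assumes c: "c \<in> carrier (simplicial_chains K d)" "coboundary K c = (\<lambda>xs. 0)"
  obtains h b where "h \<in> harmonic d" "b \<in> carrier (simplicial_chains K (d - 1))"
    "c = (\<lambda>xs. h xs + coboundary K b xs)"
proof -
  let ?U = "coboundary K ` carrier (simplicial_chains K (d - 1))"
  have U: "?U \<subseteq> carrier (simplicial_chains K d)"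
    using coboundary_in_chains[of _ K "d - 1" K] by auto
  moreover have "lin_subspace ?U"
    by (rule lin_subspace_image[OF lin_subspace_chains]) (simp_all add: coboundary_lin)
  ultimately obtain u where u: "u \<in> ?U"
    and orth: "\<And>v. v \<in> ?U \<Longrightarrow> pairing E v (\<lambda>xs. cnj (c xs - u xs)) = 0"
    using chain_orthogonal_decomposition[OF _ _ K_sub finite_E, of ?U d c] by blast
  obtain b where b: "b \<in> carrier (simplicial_chains K (d - 1))" "u = coboundary K b"
    using u by blast
  define h where "h = (\<lambda>xs. c xs - u xs)"
  have h: "h \<in> carrier (simplicial_chains K d)"
    unfolding h_def using lin_subspaceD(4)[OF lin_subspace_chains c(1)] u U by blast
  have w: "boundary K h \<in> carrier (simplicial_chains K (d - 1))"
    using boundary_in_chains(1)[of h "d - 1"] h by simp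
  have "boundary K h = (\<lambda>xs. 0)"
  proof (rule pairing_definite[OF w K_sub finite_E])
    have "pairing E (boundary K h) (\<lambda>xs. cnj (boundary K h xs)) =
        pairing E (boundary K (\<lambda>xs. cnj (h xs))) (boundary K h)"
      by (simp add: boundary_lin pairing_commute)
    also have "\<dots> = pairing E (\<lambda>xs. cnj (h xs)) (coboundary K (boundary K h))"
      by (rule pairing_boundary_chain[OF chains_cnj[OF h]])
    also have "\<dots> = pairing E (coboundary K (boundary K h)) (\<lambda>xs. cnj (c xs - u xs))"
      unfolding h_def by (rule pairing_commute)
    also have "\<dots> = 0"
      by (rule orth) (use w in blast)
    finally show "pairing E (boundary K h) (\<lambda>xs. cnj (boundary K h xs)) = 0" .
  qed
  moreover have "coboundary K h = (\<lambda>xs. 0)"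
    unfolding h_def b(2) coboundary_lin c(2) by (simp add: coboundary_coboundary[OF down])
  ultimately have "h \<in> harmonic d"
    using h by (simp add: harmonic_def cycles_def)
  moreover have "c = (\<lambda>xs. h xs + coboundary K b xs)"
    by (simp add: h_def b(2))
  ultimately show thesis
    using that b(1) by blast
qed

end

section \<open>Alexander duality\<close>

text \<open>The complementation operator is invertible, as its square is a sign.\<close>
lemma star_surj:
  assumes es: "distinct es" and K: "K \<subseteq> Pow (set es)" and c: "c \<in> carrier (simplicial_chains K d)"
  obtains b where
    "b \<in> carrier (simplicial_chains {A. A \<subseteq> set es \<and> set es - A \<in> K} (int (length es) - 2 - d))"
    "star es b = c"
proof -
  define s :: complex where "s = (- 1) ^ (nat (d + 1) * nat (int (length es) - 1 - d))"
  have s: "s * s = 1"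
    by (simp add: s_def)
  let ?b = "\<lambda>xs. s * star es c xs"
  have "?b \<in> carrier (simplicial_chains {A. A \<subseteq> set es \<and> set es - A \<in> K} (int (length es) - 2 - d))"
    by (rule lin_subspaceD(3)[OF lin_subspace_chains star_in_chains[OF es c]])
  moreover have "star es ?b = c"
    using s by (simp add: star_lin star_star[OF es K c, folded s_def] flip: mult.assoc)
  ultimately show thesis by (rule that)
qed

lemma star_inj:
  assumes es: "distinct es" and K: "K \<subseteq> Pow (set es)" and c: "c \<in> carrier (simplicial_chains K d)"
    and "star es c = (\<lambda>xs. 0)"
  shows "c = (\<lambda>xs. 0)"
  using star_star[OF es K c] by (simp add: assms(4) star_0 fun_eq_iff)

lemma simplex_homotopy:
  assumes E: "finite E" and c: "c \<in> carrier (simplicial_chains (Pow E) d)"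
  shows "boundary (Pow E) (coboundary (Pow E) c) xs + coboundary (Pow E) (boundary (Pow E) c) xs =
    of_nat (card E) * c xs"
proof (cases "set xs \<subseteq> E")
  case True
  have "boundary (Pow E) (coboundary (Pow E) c) xs = (\<Sum>v\<in>E. codiff c (v # xs))"
    using True by (simp add: boundary_Pow coboundary_def)
  moreover have "coboundary (Pow E) (boundary (Pow E) c) xs = codiff (\<lambda>xs. \<Sum>v\<in>E. c (v # xs)) xs"
    using True by (simp add: coboundary_def boundary_Pow[abs_def])
  ultimately show ?thesis
    by (simp only: sum_codiff)
next
  case False
  then have "c xs = 0"
    using c by (auto simp: simplicial_chains_iff)
  with False show ?thesis
    by (simp add: boundary_Pow coboundary_def)
qed

lemma sgn_character_square: "sgn_character g * sgn_character g = 1"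
  unfolding sgn_character_def by (metis of_int_1 of_int_mult sign_idempotent)

text \<open>Let \<open>N\<close> be the set of non-faces of \<open>K\<close>, the complements of the faces of \<open>L\<close>. The coboundary \<open>\<delta>\<close> of
  the full simplex maps cocycles of \<open>K\<close> to cocycles supported on \<open>N\<close>; it is the connecting map
  from \<open>H\<^sup>d(K)\<close> to the relative cohomology in degree \<open>d + 1\<close>, and bijective because the full simplex is
  acyclic. The complementation operator turns the latter into \<open>H\<^sub>e(L)\<close>. Representing \<open>H\<^sup>d(K)\<close> by
  harmonic chains, this is the map \<open>h \<mapsto> star (\<delta> h)\<close>.

  The assumption on \<open>E\<close> excludes an exception: for empty \<open>E\<close> the full simplex has only the
  empty face, and is not acyclic.\<close>
theorem alexander_duality:
  assumes K: "simplicial_complex_on E K" and "E \<noteq> {}"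
    and L: "L = {A. A \<subseteq> E \<and> E - A \<notin> K}"
    and G: "\<And>g. g \<in> carrier G \<Longrightarrow> g permutes E" "\<And>g A. g \<in> carrier G \<Longrightarrow> g ` A \<in> K \<longleftrightarrow> A \<in> K"
    and de: "d + e = int (card E) - 3"
  shows "cg_isomorphic G (reduced_homology L e) (tensor_character (reduced_homology K d) sgn_character)"
proof -
  interpret K: simplicial_complex_on E K by fact
  interpret full: simplicial_complex_on E "Pow E"
    using K.finite_E by unfold_locales auto
  interpret L: simplicial_complex_on E L
  proof
    fix A B assume "A \<in> L" "B \<subseteq> A"
    then show "B \<in> L"
      unfolding L using K.down[of "E - B" "E - A"] by blast
  qed (use K.finite_E L in auto)
  obtain es where es: "distinct es" "set es = E"
    using finite_distinct_list[OF K.finite_E] by blast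
  have len: "length es = card E"
    using es distinct_card by metis
  define N where "N = Pow E - K"
  have N: "N \<subseteq> Pow E" and NL: "{A. A \<subseteq> E \<and> E - A \<in> N} = L" and LN: "{A. A \<subseteq> E \<and> E - A \<in> L} = N"
    using K.K_sub by (auto simp: N_def L double_diff)
  let ?d = "boundary (Pow E)" and ?\<delta> = "coboundary (Pow E)" and ?C = "\<lambda>K k. carrier (simplicial_chains K k)"
  have zero: "c \<in> ?C N k" if "c \<in> ?C (Pow E) k" "chain_restrict K c = (\<lambda>xs. 0)" for c k
  proof -
    have "set xs \<notin> K" if "c xs \<noteq> 0" for xs
      using \<open>chain_restrict K c = (\<lambda>xs. 0)\<close> that unfolding chain_restrict_def by metis
    then show ?thesis
      using that(1) by (simp add: N_def simplicial_chains_iff)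
  qed
  have zeroN: "chain_restrict K c = (\<lambda>xs. 0)" if "c \<in> ?C N k" for c k
  proof
    fix xs
    show "chain_restrict K c xs = 0"
      using chain_nonzeroD(1)[OF that, of xs] by (auto simp: chain_restrict_def N_def)
  qed
  have restrict_cob: "chain_restrict K (?\<delta> c) = coboundary K c" for c
    using K.K_sub by (auto simp: chain_restrict_def coboundary_def fun_eq_iff)
  have restrict_lin: "chain_restrict K (\<lambda>xs. a xs - c xs) = (\<lambda>xs. chain_restrict K a xs - chain_restrict K c xs)"
    "chain_restrict K (\<lambda>xs. t * c xs) = (\<lambda>xs. t * chain_restrict K c xs)" for a c t
    by (auto simp: chain_restrict_def)
  have cob_restrict: "coboundary K (chain_restrict K c) = coboundary K c" for c
    by (rule coboundary_restrict) (rule K.down)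
  have star_L: "star es c \<in> ?C L k" if "c \<in> ?C N l" "k + l = int (card E) - 2" for c k l
  proof -
    have "k = int (card E) - 2 - l" using that(2) by simp
    then show ?thesis
      using star_in_chains[OF es(1) that(1)] by (simp add: es len NL)
  qed
  have star_from_N: "\<exists>b\<in>?C N k. star es b = c" if "c \<in> ?C L l" "k + l = int (card E) - 2" for c k l
  proof -
    have "L \<subseteq> Pow (set es)" using es L.K_sub by simp
    from star_surj[OF es(1) this that(1)]
    obtain b where "b \<in> ?C {A. A \<subseteq> set es \<and> set es - A \<in> L} (int (length es) - 2 - l)" "star es b = c" .
    moreover have "int (length es) - 2 - l = k" using that(2) len by simp
    ultimately show ?thesis by (auto simp: es LN)
  qed
  have star_0D: "c = (\<lambda>xs. 0)" if "c \<in> ?C (Pow E) k" "star es c = (\<lambda>xs. 0)" for c k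
    by (rule star_inj[OF es(1) _ that]) (simp add: es)
  define s :: complex where "s = (- 1) ^ nat (d + 1)"
  have ss: "s * s = 1" by (simp add: s_def)
  have star_cob: "star es (?\<delta> c) = (\<lambda>ys. s * ?d (star es c) ys)" if "c \<in> ?C (Pow E) d" for c
    using star_codiff[OF es(1) that] by (simp add: es s_def)
  have bdL: "boundary L c = ?d c" if "c \<in> ?C L k" for c k
    by (rule boundary_eq_boundary_Pow[OF that L.K_sub K.finite_E])
  have toPow: "c \<in> ?C (Pow E) k" if "c \<in> ?C K k \<or> c \<in> ?C N k" for c k
    using that chains_mono[OF K.K_sub] chains_mono[OF N] by blast
  have \<delta>\<delta>: "?\<delta> (?\<delta> c) = (\<lambda>xs. 0)" for c
    by (rule coboundary_coboundary) auto
  let ?n = "of_nat (card E) :: complex"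
  have n: "?n \<noteq> 0"
    using K.finite_E \<open>E \<noteq> {}\<close> by simp
  let ?f = "\<lambda>h. star es (?\<delta> h)"
  have \<delta>h: "?\<delta> h \<in> ?C N (d + 1)" if "h \<in> K.harmonic d" for h
    by (rule zero[OF coboundary_in_chains]) (use K.harmonicD[OF that] in \<open>auto simp: restrict_cob\<close>)
  show ?thesis
  proof (rule cg_isomorphic_reduced_homologyI[where H = "K.harmonic d" and f = ?f])
    show "lin_subspace (K.harmonic d)"
      by (rule K.lin_subspace_harmonic)
    show "K.harmonic d \<subseteq> cycles K d"
      by (auto simp: K.harmonic_def)
    show "?f (\<lambda>xs. h xs + k xs) = (\<lambda>xs. ?f h xs + ?f k xs)" for h k
      by (simp add: coboundary_lin star_lin)
    show "?f (\<lambda>xs. a * h xs) = (\<lambda>xs. a * ?f h xs)" for a h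
      by (simp add: coboundary_lin star_lin)
  next
    fix h assume h: "h \<in> K.harmonic d"
    have fh: "?f h \<in> ?C L e"
      by (rule star_L[OF \<delta>h[OF h]]) (use de in simp)
    have "(\<lambda>xs. 0) = star es (?\<delta> (?\<delta> h))"
      by (simp add: \<delta>\<delta> star_0)
    also have "\<dots> = (\<lambda>ys. (- 1) ^ nat (d + 1 + 1) * ?d (?f h) ys)"
      using star_codiff[OF es(1), of "?\<delta> h" N "d + 1"] \<delta>h[OF h] by (simp add: es)
    finally have "?d (?f h) = (\<lambda>xs. 0)"
      by (simp add: fun_eq_iff)
    then show "?f h \<in> cycles L e"
      using fh by (simp add: cycles_def bdL[OF fh])
    show "?f h \<in> boundaries L e \<longleftrightarrow> h \<in> boundaries K d"
    proof
      assume "h \<in> boundaries K d"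
      then have "h = (\<lambda>xs. 0)"
        by (rule K.harmonic_boundary_eq_0[OF h])
      then have "?f h = (\<lambda>xs. 0)"
        by (simp add: coboundary_lin star_0)
      then show "?f h \<in> boundaries L e"
        using lin_subspaceD(1)[OF lin_subspace_boundaries] by simp
    next
      assume "?f h \<in> boundaries L e"
      then obtain w where w: "w \<in> ?C L (e + 1)" "?f h = boundary L w"
        by (auto simp: boundaries_def)
      obtain m where m: "m \<in> ?C N d" "star es m = w"
        using star_from_N[OF w(1), of d] de by auto
      have mP: "m \<in> ?C (Pow E) d" and hP: "h \<in> ?C (Pow E) d"
        using toPow m(1) K.harmonicD(1)[OF h] by blast+
      \<comment> \<open>\<open>s\<close> undoes the sign in \<open>star_codiff\<close>, so \<open>\<delta>h\<close> and \<open>\<delta>(s m)\<close> have the same image under \<open>star\<close>.\<close>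
      define p where "p = (\<lambda>xs. h xs - s * m xs)"
      have p: "p \<in> ?C (Pow E) d"
        unfolding p_def by (intro lin_subspaceD(3,4)[OF lin_subspace_chains] hP mP)
      have "star es (?\<delta> p) = (\<lambda>ys. ?f h ys - s * (s * ?d w ys))"
        unfolding p_def coboundary_lin star_lin star_cob[OF mP] m(2) ..
      also have "\<dots> = (\<lambda>ys. 0)"
        using ss by (simp add: w(2) bdL[OF w(1)] flip: mult.assoc)
      finally have "?\<delta> p = (\<lambda>xs. 0)"
        by (rule star_0D[OF coboundary_in_chains[OF p]])
      then have np: "?\<delta> (?d p) xs = ?n * p xs" for xs
        using simplex_homotopy[OF K.finite_E p, of xs] by (simp add: boundary_lin)
      \<comment> \<open>The cocycle \<open>p\<close> of the full simplex is a coboundary, so its restriction \<open>h\<close> is one in \<open>K\<close>.\<close>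
      have "h = chain_restrict K p"
        unfolding p_def restrict_lin zeroN[OF m(1)] K.chain_restrict_chain[OF K.harmonicD(1)[OF h]] by simp
      also have "p = ?\<delta> (\<lambda>xs. (1 / ?n) * ?d p xs)"
        unfolding coboundary_lin np using n by simp
      also have "chain_restrict K \<dots> = coboundary K (\<lambda>xs. (1 / ?n) * ?d p xs)"
        by (rule restrict_cob)
      finally have "h = (\<lambda>xs. 0)"
        by (rule K.harmonic_coboundary_eq_0[OF h])
      then show "h \<in> boundaries K d"
        using lin_subspaceD(1)[OF lin_subspace_boundaries] by simp
    qed
  next
    fix z assume z: "z \<in> cycles L e"
    then have zL: "z \<in> ?C L e" and dz: "?d z = (\<lambda>xs. 0)"
      using bdL by (auto simp: cycles_def)
    obtain y\<^sub>0 where y\<^sub>0: "y\<^sub>0 \<in> ?C N (d + 1)" "star es y\<^sub>0 = z"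
      using star_from_N[OF zL, of "d + 1"] de by auto
    have y\<^sub>0P: "y\<^sub>0 \<in> ?C (Pow E) (d + 1)"
      using toPow y\<^sub>0(1) by blast
    have "star es (?\<delta> y\<^sub>0) = (\<lambda>xs. 0)"
      using star_codiff[OF es(1) y\<^sub>0(1)] by (simp add: es y\<^sub>0(2) dz)
    then have \<delta>y\<^sub>0: "?\<delta> y\<^sub>0 = (\<lambda>xs. 0)"
      by (rule star_0D[OF coboundary_in_chains[OF y\<^sub>0P]])
    \<comment> \<open>The homotopy formula exhibits the cocycle \<open>y\<^sub>0\<close> as a coboundary. The restriction of \<open>y\<close> to \<open>K\<close> is a
      cocycle, since \<open>\<delta>y\<close> lives on non-faces, and it may be changed by a coboundary to become harmonic.\<close>
    define y where "y = (\<lambda>xs. (1 / ?n) * ?d y\<^sub>0 xs)"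
    have yP: "y \<in> ?C (Pow E) d"
      unfolding y_def by (intro lin_subspaceD(3)[OF lin_subspace_chains] full.boundary_in_chains(1) y\<^sub>0P)
    have "?\<delta> (?d y\<^sub>0) xs = ?n * y\<^sub>0 xs" for xs
      using simplex_homotopy[OF K.finite_E y\<^sub>0P, of xs] by (simp add: \<delta>y\<^sub>0 boundary_lin)
    then have \<delta>y: "?\<delta> y = y\<^sub>0"
      unfolding y_def coboundary_lin using n by simp
    have "coboundary K (chain_restrict K y) = chain_restrict K (?\<delta> y)"
      by (simp only: cob_restrict restrict_cob)
    also have "\<dots> = (\<lambda>xs. 0)"
      unfolding \<delta>y by (rule zeroN[OF y\<^sub>0(1)])
    finally have cocycle: "coboundary K (chain_restrict K y) = (\<lambda>xs. 0)" .
    have "chain_restrict K y \<in> ?C K d"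
      using chain_restrict_in_chains[OF yP, of K] K.K_sub by (simp add: Int_absorb2)
    from this cocycle obtain h b where h: "h \<in> K.harmonic d" and b: "b \<in> ?C K (d - 1)"
      and yhb: "chain_restrict K y = (\<lambda>xs. h xs + coboundary K b xs)"
      by (rule K.cocycle_cohomologous_harmonic)
    \<comment> \<open>\<open>\<delta>b\<close> of the full simplex, not of \<open>K\<close>: it is killed by \<open>\<delta>\<close> and has the same restriction to \<open>K\<close>.\<close>
    define m where "m = (\<lambda>xs. y xs - h xs - ?\<delta> b xs)"
    have "?\<delta> b \<in> ?C (Pow E) d"
      using coboundary_in_chains[OF b, of "Pow E"] by simp
    then have mP: "m \<in> ?C (Pow E) d"
      unfolding m_def using K.harmonicD(1)[OF h] toPow
      by (intro lin_subspaceD(4)[OF lin_subspace_chains] yP) blast+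
    have "chain_restrict K m = (\<lambda>xs. 0)"
      unfolding m_def restrict_lin yhb restrict_cob K.chain_restrict_chain[OF K.harmonicD(1)[OF h]] by simp
    then have m: "m \<in> ?C N d"
      by (rule zero[OF mP])
    have "star es (?\<delta> m) = (\<lambda>xs. z xs - ?f h xs)"
      unfolding m_def coboundary_lin star_lin \<delta>\<delta> star_0 \<delta>y y\<^sub>0(2) by simp
    then have eq: "(\<lambda>xs. z xs - ?f h xs) = ?d (\<lambda>xs. s * star es m xs)"
      unfolding star_cob[OF mP] boundary_lin by simp
    have sm: "(\<lambda>xs. s * star es m xs) \<in> ?C L (e + 1)"
      by (intro lin_subspaceD(3)[OF lin_subspace_chains] star_L[OF m]) (use de in simp)
    have "(\<lambda>xs. z xs - ?f h xs) \<in> boundaries L e"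
      unfolding eq boundaries_def bdL[OF sm, symmetric] using sm by (rule imageI)
    then show "\<exists>h\<in>K.harmonic d. (\<lambda>xs. z xs - ?f h xs) \<in> boundaries L e"
      using h by blast
  next
    show "\<exists>h\<in>K.harmonic d. (\<lambda>xs. c xs - h xs) \<in> boundaries K d" if "c \<in> cycles K d" for c
      using K.cycle_homologous_harmonic[OF that] by blast
  next
    fix g assume g: "g \<in> carrier G"
    have perm: "g permutes E" and bij: "bij g"
      using G(1)[OF g] permutes_bij by blast+
    let ?act = "\<lambda>c xs. c (map (Hilbert_Choice.inv g) xs)"
    have inv: "g ` Hilbert_Choice.inv g ` A = A" "Hilbert_Choice.inv g ` g ` A = A" for A
      using perm by (simp_all add: image_image permutes_inverses)
    show "sgn_character g * sgn_character g = 1"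
      by (rule sgn_character_square)
    show "?act ` boundaries K d = boundaries K d"
      by (rule gact_boundaries[OF bij G(2)[OF g]])
    have "g ` A \<in> L \<longleftrightarrow> A \<in> L" for A
    proof -
      have "g ` A \<subseteq> E \<longleftrightarrow> A \<subseteq> E"
        using permutes_in_image[OF perm] by auto
      moreover have "g ` (E - A) = E - g ` A"
        using perm by (simp add: image_set_diff permutes_inj permutes_image)
      ultimately show ?thesis
        unfolding L using G(2)[OF g, of "E - A"] by auto
    qed
    then show "?act ` boundaries L e = boundaries L e"
      by (rule gact_boundaries[OF bij])
    have cob: "coboundary J (?act c) = ?act (coboundary J c)"
      if "\<And>A. g ` A \<in> J \<longleftrightarrow> A \<in> J" for J and c :: "'a list \<Rightarrow> complex"
    proof
      fix xs
      have "set (map (Hilbert_Choice.inv g) xs) \<in> J \<longleftrightarrow> set xs \<in> J"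
        using that[of "Hilbert_Choice.inv g ` set xs"] by (simp add: inv)
      then show "coboundary J (?act c) xs = ?act (coboundary J c) xs"
        by (simp add: coboundary_def codiff_map)
    qed
    fix h assume h: "h \<in> K.harmonic d"
    have "\<And>A. g ` A \<in> Pow E \<longleftrightarrow> A \<in> Pow E"
      using permutes_in_image[OF perm] by auto
    from cob[OF this] show "?f (?act h) = (\<lambda>xs. sgn_character g * ?f h (map (Hilbert_Choice.inv g) xs))"
      using star_map[OF es(1), of g "?\<delta> h"] perm by (simp add: es sgn_character_def)
    have hK: "?act h \<in> ?C K d"
      using gact_chains[OF bij G(2)[OF g], of d] K.harmonicD(1)[OF h] by blast
    have "boundary K (?act h) = ?act (boundary K h)"
      using boundary_gact[OF bij image_Union_invariant[OF bij G(2)[OF g]], of d h d] by simp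
    then show "?act h \<in> K.harmonic d"
      using hK K.harmonicD(2,3)[OF h] by (simp add: K.harmonic_def cycles_def cob[OF G(2)[OF g]])
  qed
qed

section \<open>Matroids\<close>

context matroid
begin

lemma rk_attained:
  shows "I \<in> indep M \<Longrightarrow> I \<subseteq> A \<Longrightarrow> card I \<le> rk M A"
    and "\<exists>I\<in>indep M. I \<subseteq> A \<and> card I = rk M A"
proof -
  have "indep M \<subseteq> Pow (ground M)"
    using indep_subset by blast
  then have "finite (indep M)"
    using finite_ground finite_subset by auto
  then have fin: "finite (card ` {I \<in> indep M. I \<subseteq> A})"
    by simp
  then show "I \<in> indep M \<Longrightarrow> I \<subseteq> A \<Longrightarrow> card I \<le> rk M A"
    unfolding rk_def by (intro Max_ge) auto
  have "card ` {I \<in> indep M. I \<subseteq> A} \<noteq> {}"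
    using empty_indep by auto
  from Max_in[OF fin this] show "\<exists>I\<in>indep M. I \<subseteq> A \<and> card I = rk M A"
    unfolding rk_def by auto
qed

lemma nonspanning_iff_no_basis:
  assumes "A \<subseteq> ground M"
  shows "rk M A < rk M (ground M) \<longleftrightarrow> \<not> (\<exists>B\<in>bases M. B \<subseteq> A)"
proof
  assume less: "rk M A < rk M (ground M)"
  show "\<not> (\<exists>B\<in>bases M. B \<subseteq> A)"
  proof (intro notI, elim bexE)
    fix B assume B: "B \<in> bases M" "B \<subseteq> A"
    obtain I where I: "I \<in> indep M" "card I = rk M (ground M)"
      using rk_attained(2) by blast
    have "card B \<le> rk M A"
      using B by (intro rk_attained(1)) (simp_all add: bases_def)
    then obtain x where "x \<in> I - B" "insert x B \<in> indep M"
      using augmentation[of B I] B(1) I less by (auto simp: bases_def)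
    then show False
      using B(1) by (auto simp: bases_def)
  qed
next
  assume no: "\<not> (\<exists>B\<in>bases M. B \<subseteq> A)"
  show "rk M A < rk M (ground M)"
  proof (rule ccontr)
    assume "\<not> rk M A < rk M (ground M)"
    then obtain I where I: "I \<in> indep M" "I \<subseteq> A" "rk M (ground M) \<le> card I"
      using rk_attained(2)[of A] by auto
    have "J = I" if "J \<in> indep M" "I \<subseteq> J" for J
    proof (rule sym, rule card_seteq)
      show "finite J"
        using that(1) indep_subset finite_ground finite_subset by blast
      have "card J \<le> rk M (ground M)"
        using that(1) indep_subset by (intro rk_attained(1))
      then show "card J \<le> card I"
        using I(3) by simp
    qed (rule that(2))
    then have "I \<in> bases M"
      using I(1) by (simp add: bases_def)
    then show False
      using no I(2) by blast
  qed
qed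

text \<open>\<open>A\<close> is spanning iff it contains a basis \<open>B\<close>, iff its complement avoids \<open>B\<close>, that is, iff the complement
  is independent in the dual matroid.\<close>
lemma NS_eq_alexander_dual: "NS M = {A. A \<subseteq> ground M \<and> ground M - A \<notin> IN (dual M)}"
proof -
  have "(ground M - A \<in> IN (dual M)) \<longleftrightarrow> (\<exists>B\<in>bases M. B \<subseteq> A)" if "A \<subseteq> ground M" for A
  proof -
    have "ground M - A \<subseteq> ground M - B \<longleftrightarrow> B \<subseteq> A" if "B \<in> bases M" for B
      using that \<open>A \<subseteq> ground M\<close> indep_subset[of B] by (auto simp: bases_def)
    then show ?thesis
      by (auto simp: IN_def dual_def)
  qed
  then show ?thesis
    using nonspanning_iff_no_basis by (auto simp: NS_def)
qed

lemma simplicial_complex_IN_dual: "simplicial_complex_on (ground M) (IN (dual M))"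
  by unfold_locales (use finite_ground in \<open>auto simp: IN_def dual_def\<close>)

end

theorem theorem16:
  fixes M :: "'a set_system" and n i :: nat
  assumes "matroid M" and "card (ground M) = n"
  shows "cg_isomorphic (aut_group M)
    (reduced_homology (NS M) (int i))
    (tensor_character (reduced_homology (IN (dual M)) (int n - 3 - int i)) sgn_character)"
proof -
  interpret matroid M by fact
  show ?thesis
  proof (cases "ground M = {}")
    case False
    show ?thesis
    proof (rule alexander_duality[OF simplicial_complex_IN_dual False NS_eq_alexander_dual])
      show "g permutes ground M" if "g \<in> carrier (aut_group M)" for g
        using that by (simp add: aut_group_def)
      show "g ` A \<in> IN (dual M) \<longleftrightarrow> A \<in> IN (dual M)" if "g \<in> carrier (aut_group M)" for g A
        by (rule aut_dual[OF that])
    qed (simp add: assms(2))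
  next
    case True
    \<comment> \<open>Over the empty ground set chains live in degree \<open>- 1\<close> only. Neither \<open>i\<close> nor \<open>- 3 - i\<close>, nor the
      degree above either of them, is \<open>- 1\<close>, so that both homology spaces vanish.\<close>
    have chain_0: "c = (\<lambda>xs. 0)"
      if K: "K \<subseteq> Pow (ground M)" and d: "d \<noteq> - 1" and c: "c \<in> carrier (simplicial_chains K d)" for K d c
    proof
      fix xs
      show "c xs = 0"
        using chain_nonzeroD[OF c, of xs] K d True by fastforce
    qed
    let ?Z = "{\<lambda>xs :: 'a list. 0 :: complex}"
    have cyc: "cycles K d = ?Z" and bnd: "boundaries K d = ?Z"
      if K: "K \<subseteq> Pow (ground M)" and d: "d \<noteq> - 1" "d + 1 \<noteq> - 1" for K d
    proof -
      note zero = lin_subspaceD(1)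
      have "cycles K d \<subseteq> ?Z"
        using chain_0[OF K d(1)] by (auto simp: cycles_def)
      then show "cycles K d = ?Z"
        using zero[OF lin_subspace_cycles] by blast
      have "boundaries K d \<subseteq> ?Z"
      proof
        fix b assume "b \<in> boundaries K d"
        then obtain c where c: "c \<in> carrier (simplicial_chains K (d + 1))" "b = boundary K c"
          by (auto simp: boundaries_def)
        show "b \<in> ?Z"
          using chain_0[OF K d(2) c(1)] by (simp add: c(2) boundary_lin)
      qed
      then show "boundaries K d = ?Z"
        using zero[OF lin_subspace_boundaries] by blast
    qed
    have sub: "NS M \<subseteq> Pow (ground M)" "IN (dual M) \<subseteq> Pow (ground M)"
      by (auto simp: NS_def IN_def dual_def)
    have n: "n = 0"
      using True assms(2) by simp
    have *: "cycles (NS M) (int i) = ?Z" "boundaries (NS M) (int i) = ?Z"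
      "cycles (IN (dual M)) (int n - 3 - int i) = ?Z" "boundaries (IN (dual M)) (int n - 3 - int i) = ?Z"
      using cyc[OF sub(1), of "int i"] bnd[OF sub(1), of "int i"]
        cyc[OF sub(2), of "int n - 3 - int i"] bnd[OF sub(2), of "int n - 3 - int i"]
      by (simp_all add: n)
    show ?thesis
    proof (rule cg_isomorphic_reduced_homologyI[where H = ?Z and f = "\<lambda>h. h"])
      show "sgn_character g * sgn_character g = 1" for g :: "'a \<Rightarrow> 'a"
        by (rule sgn_character_square)
    qed (simp_all add: * lin_subspace_def)
  qed
qed

end
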